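(* Let $E\subset\mathfrak{LC}$ have $L^1_{loc}$-equicontinuous $m$-bounds. Then there exist a suitable set of moduli of continuity $\Theta=(\Theta_1,\Theta_2)$, with $\Theta_1=\{\theta_j^I: j\in\mathbb N,\ I=[q_1,q_2],\ q_1,q_2\in\mathbb Q\}$ and $\Theta_2=\{\theta_j^{I,\nu}: j,\nu\in\mathbb N,\ I=[q_1,q_2],\ q_1,q_2\in\mathbb Q,\ q_1+1/\nu<q_2\}$, and a suitable set of radii $\mathcal R=\{R_j^I: j\in\mathbb N,\ I=[q_1,q_2],\ q_1,q_2\in\mathbb Q\}$, associated to $E$, such that, if $\mathcal K_j^I$ are the sets of functions determined by $\Theta$ and $\mathcal R$ (defined in the context), the following holds: if $I=[q_1,q_2]$ with $q_1,q_2\in\mathbb Q$, $f\in E$, $z\in X$, and $u(\cdot,f,z)$ is the mild solution on $I$ of the problem $u'(t)=A\,u(t)+\tilde f(t,u(t))$, $t>q_1$, $u(q_1)=z$, and if for some $j\ge1$ one has $\|u(t,f,z)\|\le j$ for all $t\in I$, then $u(\cdot,f,z)\in\mathcal K_j^I$.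
   Context: Setting. $M,N\ge 1$; $U\subset\mathbb R^M$ is a bounded, open, connected set with sufficiently smooth boundary; $|y|=|y_1|+\dots+|y_N|$ on $\mathbb R^N$; $B_j\subset\mathbb R^N$ is the closed ball of radius $j$ centered at $0$; $L^1_{loc}$ is the space of locally integrable functions $\mathbb R\to\mathbb R$; $\mathbb R^+=[0,\infty)$; $\mathbb N=\{1,2,\dots\}$; intervals $[q_1,q_2]$ have $q_1<q_2$. One fixes Neumann, Robin or Dirichlet boundary conditions: for $1\le i\le N$, $\alpha_i(x)y_i+\kappa\,\partial y_i/\partial n=0$ on $\partial U$, with $\kappa=0,\alpha_i\equiv1$ (Dirichlet), $\kappa=1,\alpha_i\equiv 0$ (Neumann), or $\kappa=1$ and $\alpha_i:\partial U\to\mathbb R$ nonnegative and sufficiently regular (Robin). Put $Y=C(\overline U)$, $X=C(\overline U,\mathbb R^N)$ in the Neumann/Robin case, and $Y=C_0(\overline U)$, $X=C_0(\overline U,\mathbb R^N)$ (continuous functions vanishing on $\partial U$) in the Dirichlet case. $\|z\|=\sup_{x\in\overline U}|z(x)|$; $\mathcal B_j=C(\overline U,B_j)$ is the closed ball of radius $j$ in $C(\overline U,\mathbb R^N)$ and $\mathcal B_j^X=\mathcal B_j\cap X$ (same notation for any real radius). Semigroup. $A_i$ is the closure in $Y$ of $A_i^0z_i=\Delta z_i$ with domain $\{z_i\in C^2(U)\cap C^1(\overline U): \Delta z_i\in C(\overline U),\ \alpha_i z_i+\partial z_i/\partial n=0 \text{ on }\partial U\}$ (Neumann/Robin), resp.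 $\{z_i\in C^2(U)\cap C_0(\overline U):\Delta z_i\in C_0(\overline U)\}$ (Dirichlet). It is a known fact (the regularity of $\partial U$ and $\alpha_i$ is assumed sufficient for it) that $A_i$ is sectorial and generates a strongly continuous analytic semigroup $(e^{tA_i})_{t\ge0}$ on $Y$, with $e^{tA_i}$ compact for $t>0$ and $\|e^{tA_i}\|\le1$. Then $A=\prod_{i=1}^N A_i$ on $X=Y^N$, $e^{tA}=\prod_i e^{tA_i}$, and $\|e^{tA}\|\le N$ for all $t\ge0$ in the operator norm associated to $\|\cdot\|$. Carathéodory maps. $f:\mathbb R\times\overline U\times\mathbb R^N\to\mathbb R^N$ is in $\mathfrak{SC}$ if it is Borel measurable; for every compact $K\subset\mathbb R^N$ there is a nonnegative $m^K\in L^1_{loc}$ (an $m$-bound on $K$) with, for a.e. $t$, $|f(t,x,y)|\le m^K(t)$ for all $x\in\overline U$, $y\in K$; and for a.e. $t$ the map $f(t,\cdot,\cdot)$ is continuous. $f\in\mathfrak{LC}$ if moreover for every compact $K$ there is a nonnegative $l^K\in L^1_{loc}$ (an $l$-bound on $K$) such that for a.e. $t$, $|f(t,x,y_1)-f(t,x,y_2)|\le l^K(t)|y_1-y_2|$ for all $x\in\overline U$, $y_1,y_2\in K$. In the Dirichlet case it is a standing assumption that all maps $f$ considered satisfy $f(t,x,0)=0$ for all $t\in\mathbb R$, $x\in\partial U$. Set $\tilde f(t,z)(x)=f(t,x,z(x))$. $E\subset\mathfrak{LC}$ has $L^1_{loc}$-equicontinuous $m$-bounds if for every $j\in\mathbb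 N$ there is a set $S^j\subset L^1_{loc}$ of $m$-bounds on $B_j$ of the functions of $E$ (containing one for each $f\in E$) such that for all $r,\varepsilon>0$ there is $\delta>0$ with $\sup_{m\in S^j}\int_{t_1}^{t_2}m<\varepsilon$ whenever $-r\le t_1\le t_2\le r$, $t_2-t_1<\delta$. Mild solution. $u\in C([q_1,q_2],X)$ with $u(q_1)=z$ and $u(t)=e^{(t-q_1)A}z+\int_{q_1}^t e^{(t-s)A}\tilde f(s,u(s))\,ds$ for $t\in[q_1,q_2]$ (Bochner integral). Suitable set of moduli of continuity. $\Theta=(\Theta_1,\Theta_2)$, where all $\theta_j^I\in\Theta_1$ and $\theta_j^{I,\nu}\in\Theta_2$ (indices as in the claim) are non-decreasing functions in $C(\mathbb R^+,\mathbb R^+)$ vanishing at $0$ such that $\theta_{j_1}^{I_1}\le\theta_{j_2}^{I_2}$ whenever $I_1\subseteq I_2$, $j_1\le j_2$, and $\theta_{j_1}^{I_1,\nu_1}\le\theta_{j_2}^{I_2,\nu_2}$ whenever $I_1\subseteq I_2$, $\nu_1\le\nu_2$, $j_1\le j_2$ (with $1/\nu_1$ smaller than the length of $I_1$). Suitable set of radii: positive constants $R_j^I$ with $R_{j_1}^{I_1}\le R_{j_2}^{I_2}$ whenever $I_1\subseteq I_2$, $j_1\le j_2$. Sets $\mathcal K_j^I$. Given $\Theta$ and $\mathcal R$, $\mathcal K_j^I$ is the set of $v\in C(I,\mathcal B_j)$ such that for every $J=[r_1,r_2]\subseteq I$ with $r_1,r_2\in\mathbb Q$ and every integer $\nu\ge1$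 with $r_1+1/\nu<r_2$: (i) $\|v(t_1)-v(t_2)\|\le\theta_j^{J,\nu}(|t_1-t_2|)+\theta_j^J(1/\nu)$ for all $t_1,t_2\in[r_1+1/\nu,r_2]$; (ii) $\mathrm d\big(v(t),e^{\frac1\nu A}\mathcal B^X_{R_j^J}\big)\le\theta_j^J(1/\nu)$ for all $t\in[r_1+1/\nu,r_2]$, where $\mathrm d(z,F)=\inf_{\tilde z\in F}\|z-\tilde z\|$. *)

theory Defs
  imports "HOL-Analysis.Analysis" "HOL-Library.Function_Algebras"
begin

section \<open>Spaces of continuous functions on the closure of the domain\<close>

definition norm1 :: "real ^ 'n \<Rightarrow> real" where
  "norm1 y = (\<Sum>i\<in>UNIV. \<bar>y $ i\<bar>)"

definition ball1 :: "real \<Rightarrow> (real ^ 'n) set" where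
  "ball1 r = {y. norm1 y \<le> r}"

datatype ('x, 'i) bdry_cond = Dirichlet | Neumann | Robin "'i \<Rightarrow> 'x \<Rightarrow> real"

text \<open>
  Functions on \<open>closure U\<close> are represented by total functions that vanish outside \<open>closure U\<close>, so
  that equality of functions is equality on \<open>closure U\<close>. Sums and differences of functions are
  pointwise.
\<close>

definition Cbar :: "'x::topological_space set \<Rightarrow> ('x \<Rightarrow> 'b::{topological_space, zero}) set" where
  "Cbar U = {z. continuous_on (closure U) z \<and> (\<forall>x. x \<notin> closure U \<longrightarrow> z x = 0)}"

text \<open>
  The space in which the equation is posed: all continuous functions under Neumann or Robin
  conditions, those vanishing on the boundary under Dirichlet conditions. With values in
  \<open>real\<close> this is \<open>Y\<close>, with values in \<open>real ^ 'n\<close> it is \<open>X\<close>, and with values in \<open>complex\<close> it is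
  the complexification of \<open>Y\<close>.
\<close>

definition bc_space ::
  "'x::topological_space set \<Rightarrow> ('x, 'i) bdry_cond \<Rightarrow> ('x \<Rightarrow> 'b::{topological_space, zero}) set" where
  "bc_space U bc = {z \<in> Cbar U. bc = Dirichlet \<longrightarrow> (\<forall>x\<in>frontier U. z x = 0)}"

definition sup_norm :: "'x::topological_space set \<Rightarrow> ('b \<Rightarrow> real) \<Rightarrow> ('x \<Rightarrow> 'b) \<Rightarrow> real" where
  "sup_norm U p z = (SUP x\<in>closure U. p (z x))"

abbreviation normX :: "'x::topological_space set \<Rightarrow> ('x \<Rightarrow> real ^ 'n) \<Rightarrow> real" where
  "normX U \<equiv> sup_norm U norm1"

abbreviation normY :: "'x::topological_space set \<Rightarrow> ('x \<Rightarrow> 'b::real_normed_vector) \<Rightarrow> real" where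
  "normY U \<equiv> sup_norm U norm"

definition cball_C :: "'x::topological_space set \<Rightarrow> real \<Rightarrow> ('x \<Rightarrow> real ^ 'n) set" where
  "cball_C U r = {z \<in> Cbar U. \<forall>x\<in>closure U. z x \<in> ball1 r}"

text \<open>Norm continuity of a curve \<open>u\<close> of functions, for a norm \<open>nrm\<close> on the functions.\<close>

definition cont_curve :: "(('x \<Rightarrow> 'b::ab_group_add) \<Rightarrow> real) \<Rightarrow> real set \<Rightarrow> (real \<Rightarrow> 'x \<Rightarrow> 'b) \<Rightarrow> bool" where
  "cont_curve nrm I u \<longleftrightarrow> (\<forall>t\<in>I. ((\<lambda>s. nrm (u s - u t)) \<longlongrightarrow> 0) (at t within I))"


section \<open>The domain and its outer normal\<close>

text \<open>
  The vector \<open>n\<close> is the outer unit normal at the boundary point \<open>p\<close> if, near \<open>p\<close>, the set \<open>U\<close> is a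
  sublevel set of a continuously differentiable function whose gradient \<open>g\<close> does not vanish and has
  the direction \<open>n\<close> at \<open>p\<close>. The definition is also meaningful in dimension one.
\<close>

definition is_outer_normal :: "(real ^ 'm) set \<Rightarrow> real ^ 'm \<Rightarrow> real ^ 'm \<Rightarrow> bool" where
  "is_outer_normal U p n \<longleftrightarrow> (\<exists>V \<rho> g. open V \<and> p \<in> V \<and>
     (\<forall>x\<in>V. (\<rho> has_derivative (\<lambda>h. g x \<bullet> h)) (at x) \<and> g x \<noteq> 0) \<and> continuous_on V g \<and>
     U \<inter> V = {x \<in> V. \<rho> x < (0::real)} \<and> n = g p /\<^sub>R norm (g p))"

definition outer_normal :: "(real ^ 'm) set \<Rightarrow> real ^ 'm \<Rightarrow> real ^ 'm" where
  "outer_normal U p = (THE n. is_outer_normal U p n)"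

text \<open>
  A \<open>C\<^sup>1\<close> boundary is what the notion of normal derivative requires. Whatever further regularity of
  the boundary and of the Robin coefficients is needed for the Laplacian to generate an analytic
  semigroup enters through \<open>laplace_semigroup\<close> below.
\<close>

definition smooth_domain :: "(real ^ 'm) set \<Rightarrow> bool" where
  "smooth_domain U \<longleftrightarrow> U \<noteq> {} \<and> open U \<and> connected U \<and> bounded U \<and>
     (\<forall>p\<in>frontier U. \<exists>n. is_outer_normal U p n)"

definition admissible_bc :: "(real ^ 'm) set \<Rightarrow> (real ^ 'm, 'i) bdry_cond \<Rightarrow> bool" where
  "admissible_bc U bc \<longleftrightarrow> (\<forall>\<alpha>. bc = Robin \<alpha> \<longrightarrow>
     (\<forall>i. continuous_on (frontier U) (\<alpha> i) \<and> (\<forall>x\<in>frontier U. 0 \<le> \<alpha> i x)))"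

definition bc_coeff :: "('x, 'i) bdry_cond \<Rightarrow> 'i \<Rightarrow> 'x \<Rightarrow> real" where
  "bc_coeff bc i x = (case bc of Dirichlet \<Rightarrow> 1 | Neumann \<Rightarrow> 0 | Robin \<alpha> \<Rightarrow> \<alpha> i x)"


section \<open>The Laplacian, its closure and the semigroup\<close>

text \<open>
  Unbounded operators are given by their graphs. In \<open>laplace0\<close>, the functions \<open>G\<close> and \<open>H\<close> are the
  gradient and the Hessian matrix of \<open>z\<close>. Membership of \<open>z\<close> in \<open>C\<^sup>1(closure U)\<close> means that the
  gradient extends continuously to \<open>closure U\<close>, and \<open>G\<close> is then this extension.
\<close>

definition laplace0 ::
  "(real ^ 'm) set \<Rightarrow> (real ^ 'm, 'i) bdry_cond \<Rightarrow> 'i \<Rightarrow> ((real ^ 'm \<Rightarrow> real) \<times> (real ^ 'm \<Rightarrow> real)) set" where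
  "laplace0 U bc i = {(z, w). z \<in> bc_space U bc \<and> w \<in> bc_space U bc \<and>
     (\<exists>G H. (\<forall>x\<in>U. (z has_derivative (\<lambda>h. G x \<bullet> h)) (at x) \<and>
                    (G has_derivative (\<lambda>h. H x *v h)) (at x) \<and>
                    w x = trace (H x)) \<and>
            continuous_on U H \<and>
            (bc \<noteq> Dirichlet \<longrightarrow> continuous_on (closure U) G \<and>
               (\<forall>p\<in>frontier U. bc_coeff bc i p * z p + G p \<bullet> outer_normal U p = 0)))}"

definition graph_closure ::
  "('x \<Rightarrow> 'b::ab_group_add) set \<Rightarrow> (('x \<Rightarrow> 'b) \<Rightarrow> real) \<Rightarrow>
   (('x \<Rightarrow> 'b) \<times> ('x \<Rightarrow> 'b)) set \<Rightarrow> (('x \<Rightarrow> 'b) \<times> ('x \<Rightarrow> 'b)) set" where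
  "graph_closure V nrm A = {(z, w). z \<in> V \<and> w \<in> V \<and>
     (\<forall>\<epsilon>>0. \<exists>(z', w')\<in>A. nrm (z - z') < \<epsilon> \<and> nrm (w - w') < \<epsilon>)}"

definition laplace ::
  "(real ^ 'm) set \<Rightarrow> (real ^ 'm, 'i) bdry_cond \<Rightarrow> 'i \<Rightarrow> ((real ^ 'm \<Rightarrow> real) \<times> (real ^ 'm \<Rightarrow> real)) set" where
  "laplace U bc i = graph_closure (bc_space U bc) (normY U) (laplace0 U bc i)"

definition bdd_linear_on ::
  "('x \<Rightarrow> 'b::real_vector) set \<Rightarrow> (('x \<Rightarrow> 'b) \<Rightarrow> real) \<Rightarrow> (('x \<Rightarrow> 'b) \<Rightarrow> ('x \<Rightarrow> 'b)) \<Rightarrow> bool" where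
  "bdd_linear_on V nrm L \<longleftrightarrow> (\<forall>z\<in>V. L z \<in> V) \<and>
     (\<forall>z\<in>V. \<forall>w\<in>V. L (z + w) = L z + L w) \<and>
     (\<forall>c. \<forall>z\<in>V. L (\<lambda>x. c *\<^sub>R z x) = (\<lambda>x. c *\<^sub>R L z x)) \<and>
     (\<exists>C. \<forall>z\<in>V. nrm (L z) \<le> C * nrm z)"

definition op_norm ::
  "('x \<Rightarrow> 'b) set \<Rightarrow> (('x \<Rightarrow> 'b) \<Rightarrow> real) \<Rightarrow> (('x \<Rightarrow> 'b) \<Rightarrow> ('x \<Rightarrow> 'b)) \<Rightarrow> real" where
  "op_norm V nrm L = (SUP z\<in>{z \<in> V. nrm z \<le> 1}. nrm (L z))"

definition compact_op ::
  "('x \<Rightarrow> 'b::ab_group_add) set \<Rightarrow> (('x \<Rightarrow> 'b) \<Rightarrow> real) \<Rightarrow> (('x \<Rightarrow> 'b) \<Rightarrow> ('x \<Rightarrow> 'b)) \<Rightarrow> bool" where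
  "compact_op V nrm L \<longleftrightarrow> (\<forall>z. (\<forall>k. z k \<in> V \<and> nrm (z k) \<le> 1) \<longrightarrow>
     (\<exists>w\<in>V. \<exists>r::nat \<Rightarrow> nat. strict_mono r \<and> (\<lambda>k. nrm (L (z (r k)) - w)) \<longlonglongrightarrow> 0))"

definition C0_semigroup ::
  "('x \<Rightarrow> 'b::real_vector) set \<Rightarrow> (('x \<Rightarrow> 'b) \<Rightarrow> real) \<Rightarrow> (real \<Rightarrow> ('x \<Rightarrow> 'b) \<Rightarrow> ('x \<Rightarrow> 'b)) \<Rightarrow> bool" where
  "C0_semigroup V nrm S \<longleftrightarrow> (\<forall>t\<ge>0. bdd_linear_on V nrm (S t)) \<and>
     (\<forall>z\<in>V. S 0 z = z) \<and>
     (\<forall>s\<ge>0. \<forall>t\<ge>0. \<forall>z\<in>V. S (s + t) z = S s (S t z)) \<and>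
     (\<forall>z\<in>V. ((\<lambda>t. nrm (S t z - z)) \<longlongrightarrow> 0) (at_right 0))"

definition generator ::
  "('x \<Rightarrow> 'b::real_vector) set \<Rightarrow> (('x \<Rightarrow> 'b) \<Rightarrow> real) \<Rightarrow> (real \<Rightarrow> ('x \<Rightarrow> 'b) \<Rightarrow> ('x \<Rightarrow> 'b)) \<Rightarrow>
   (('x \<Rightarrow> 'b) \<times> ('x \<Rightarrow> 'b)) set" where
  "generator V nrm S = {(z, w). z \<in> V \<and> w \<in> V \<and>
     ((\<lambda>t. nrm (\<lambda>x. (S t z x - z x) /\<^sub>R t - w x)) \<longlongrightarrow> 0) (at_right 0)}"

text \<open>Sectoriality and analyticity refer to the complexification, as spectral notions do.\<close>

definition complexify_graph :: "(('x \<Rightarrow> real) \<times> ('x \<Rightarrow> real)) set \<Rightarrow> (('x \<Rightarrow> complex) \<times> ('x \<Rightarrow> complex)) set" where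
  "complexify_graph A = {(z, v). (Re \<circ> z, Re \<circ> v) \<in> A \<and> (Im \<circ> z, Im \<circ> v) \<in> A}"

text \<open>In the next definition \<open>z\<close> solves the resolvent equation \<open>\<mu> z - A z = w\<close>.\<close>

definition sectorial ::
  "'x::topological_space set \<Rightarrow> ('x, 'i) bdry_cond \<Rightarrow> (('x \<Rightarrow> real) \<times> ('x \<Rightarrow> real)) set \<Rightarrow> bool" where
  "sectorial U bc A \<longleftrightarrow> (\<exists>\<omega> \<phi> C. pi / 2 < \<phi> \<and> \<phi> < pi \<and>
     (\<forall>\<mu>::complex. \<mu> \<noteq> of_real \<omega> \<and> \<bar>Arg (\<mu> - of_real \<omega>)\<bar> < \<phi> \<longrightarrow>
       (\<forall>w\<in>bc_space U bc.
          (\<exists>!z. (z, \<lambda>x. \<mu> * z x - w x) \<in> complexify_graph A) \<and>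
          (\<forall>z. (z, \<lambda>x. \<mu> * z x - w x) \<in> complexify_graph A \<longrightarrow>
             normY U z \<le> C / cmod (\<mu> - of_real \<omega>) * normY U w))))"

definition analytic_semigroup ::
  "'x::topological_space set \<Rightarrow> ('x, 'i) bdry_cond \<Rightarrow> (real \<Rightarrow> ('x \<Rightarrow> real) \<Rightarrow> ('x \<Rightarrow> real)) \<Rightarrow> bool" where
  "analytic_semigroup U bc S \<longleftrightarrow> (\<exists>\<delta> Z.
     let YC = (bc_space U bc :: ('x \<Rightarrow> complex) set);
         \<Sigma> = {\<mu>::complex. \<mu> \<noteq> 0 \<and> \<bar>Arg \<mu>\<bar> < \<delta>};
         bounded_op = (\<lambda>L. bdd_linear_on YC (normY U) L \<and>
                           (\<forall>c. \<forall>z\<in>YC. L (\<lambda>x. c * z x) = (\<lambda>x. c * L z x)))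
     in 0 < \<delta> \<and> \<delta> \<le> pi / 2 \<and>
        (\<forall>\<mu>\<in>\<Sigma>. bounded_op (Z \<mu>)) \<and>
        (\<forall>t>0. \<forall>z\<in>YC. Z (of_real t) z = (\<lambda>x. Complex (S t (Re \<circ> z) x) (S t (Im \<circ> z) x))) \<and>
        (\<forall>\<mu>\<in>\<Sigma>. \<forall>\<mu>'\<in>\<Sigma>. \<forall>z\<in>YC. Z (\<mu> + \<mu>') z = Z \<mu> (Z \<mu>' z)) \<and>
        (\<forall>\<mu>\<in>\<Sigma>. \<exists>D. bounded_op D \<and>
           ((\<lambda>\<mu>'. op_norm YC (normY U) (\<lambda>z x. (Z \<mu>' z x - Z \<mu> z x) / (\<mu>' - \<mu>) - D z x)) \<longlongrightarrow> 0)
             (at \<mu>)) \<and>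
        (\<forall>\<delta>'. 0 < \<delta>' \<and> \<delta>' < \<delta> \<longrightarrow> (\<forall>z\<in>YC.
           ((\<lambda>\<mu>. normY U (Z \<mu> z - z)) \<longlongrightarrow> 0) (at 0 within {\<mu>. \<mu> \<noteq> 0 \<and> \<bar>Arg \<mu>\<bar> \<le> \<delta>'}))))"

text \<open>
  The family \<open>S\<close> is the semigroup generated by the realization of the Laplacian with the \<open>i\<close>-th
  boundary condition. A strongly continuous semigroup is determined by its generator, so \<open>S\<close> is
  unique as an action on \<open>Y\<close> in nonnegative times.
\<close>

definition laplace_semigroup ::
  "(real ^ 'm) set \<Rightarrow> (real ^ 'm, 'i) bdry_cond \<Rightarrow> 'i \<Rightarrow>
   (real \<Rightarrow> (real ^ 'm \<Rightarrow> real) \<Rightarrow> (real ^ 'm \<Rightarrow> real)) \<Rightarrow> bool" where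
  "laplace_semigroup U bc i S \<longleftrightarrow>
     sectorial U bc (laplace U bc i) \<and>
     C0_semigroup (bc_space U bc) (normY U) S \<and>
     generator (bc_space U bc) (normY U) S = laplace U bc i \<and>
     analytic_semigroup U bc S \<and>
     (\<forall>t>0. compact_op (bc_space U bc) (normY U) (S t)) \<and>
     (\<forall>t\<ge>0. op_norm (bc_space U bc) (normY U) (S t) \<le> 1)"

definition prod_semigroup ::
  "('n::finite \<Rightarrow> real \<Rightarrow> ('x \<Rightarrow> real) \<Rightarrow> ('x \<Rightarrow> real)) \<Rightarrow> real \<Rightarrow> ('x \<Rightarrow> real ^ 'n) \<Rightarrow> ('x \<Rightarrow> real ^ 'n)" where
  "prod_semigroup S t z = (\<lambda>x. \<chi> i. S i t (\<lambda>y. z y $ i) x)"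


section \<open>Caratheodory maps\<close>

definition L1_loc :: "(real \<Rightarrow> real) set" where
  "L1_loc = {m. \<forall>K. compact K \<longrightarrow> set_integrable lebesgue K m}"

definition m_bound ::
  "'x::topological_space set \<Rightarrow> (real \<Rightarrow> 'x \<Rightarrow> real ^ 'n \<Rightarrow> real ^ 'n) \<Rightarrow> (real ^ 'n) set \<Rightarrow> (real \<Rightarrow> real) \<Rightarrow> bool" where
  "m_bound U f K m \<longleftrightarrow> m \<in> L1_loc \<and> (\<forall>t. 0 \<le> m t) \<and>
     (AE t in lebesgue. \<forall>x\<in>closure U. \<forall>y\<in>K. norm1 (f t x y) \<le> m t)"

definition l_bound ::
  "'x::topological_space set \<Rightarrow> (real \<Rightarrow> 'x \<Rightarrow> real ^ 'n \<Rightarrow> real ^ 'n) \<Rightarrow> (real ^ 'n) set \<Rightarrow> (real \<Rightarrow> real) \<Rightarrow> bool" where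
  "l_bound U f K l \<longleftrightarrow> l \<in> L1_loc \<and> (\<forall>t. 0 \<le> l t) \<and>
     (AE t in lebesgue. \<forall>x\<in>closure U. \<forall>y1\<in>K. \<forall>y2\<in>K.
        norm1 (f t x y1 - f t x y2) \<le> l t * norm1 (y1 - y2))"

definition SC :: "(real ^ 'm) set \<Rightarrow> (real \<Rightarrow> real ^ 'm \<Rightarrow> real ^ 'n \<Rightarrow> real ^ 'n) set" where
  "SC U = {f.
     (\<lambda>(t, x, y). f t x y) \<in> borel_measurable (restrict_space borel (UNIV \<times> closure U \<times> UNIV)) \<and>
     (\<forall>K. compact K \<longrightarrow> (\<exists>m. m_bound U f K m)) \<and>
     (AE t in lebesgue. continuous_on (closure U \<times> UNIV) (\<lambda>(x, y). f t x y))}"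

definition LC :: "(real ^ 'm) set \<Rightarrow> (real \<Rightarrow> real ^ 'm \<Rightarrow> real ^ 'n \<Rightarrow> real ^ 'n) set" where
  "LC U = {f \<in> SC U. \<forall>K. compact K \<longrightarrow> (\<exists>l. l_bound U f K l)}"

definition dirichlet_compatible ::
  "'x::topological_space set \<Rightarrow> ('x, 'n) bdry_cond \<Rightarrow> (real \<Rightarrow> 'x \<Rightarrow> real ^ 'n \<Rightarrow> real ^ 'n) \<Rightarrow> bool" where
  "dirichlet_compatible U bc f \<longleftrightarrow> (bc = Dirichlet \<longrightarrow> (\<forall>t. \<forall>x\<in>frontier U. f t x 0 = 0))"

text \<open>The supremum is taken in the extended reals, so that it is meaningful also for empty or
  unbounded families.
\<close>

definition equicontinuous_m_bounds ::
  "'x::topological_space set \<Rightarrow> (real \<Rightarrow> 'x \<Rightarrow> real ^ 'n \<Rightarrow> real ^ 'n) set \<Rightarrow> bool" where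
  "equicontinuous_m_bounds U E \<longleftrightarrow> (\<forall>j::nat. j \<ge> 1 \<longrightarrow> (\<exists>Sj.
     (\<forall>m\<in>Sj. \<exists>f\<in>E. m_bound U f (ball1 (real j)) m) \<and>
     (\<forall>f\<in>E. \<exists>m\<in>Sj. m_bound U f (ball1 (real j)) m) \<and>
     (\<forall>r>0. \<forall>\<epsilon>>0. \<exists>\<delta>>0. \<forall>t1 t2. - r \<le> t1 \<and> t1 \<le> t2 \<and> t2 \<le> r \<and> t2 - t1 < \<delta> \<longrightarrow>
        (SUP m\<in>Sj. ereal (set_lebesgue_integral lebesgue {t1..t2} m)) < ereal \<epsilon>)))"

definition nemytskii ::
  "'x::topological_space set \<Rightarrow> (real \<Rightarrow> 'x \<Rightarrow> real ^ 'n \<Rightarrow> real ^ 'n) \<Rightarrow> real \<Rightarrow> ('x \<Rightarrow> real ^ 'n) \<Rightarrow> ('x \<Rightarrow> real ^ 'n)" where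
  "nemytskii U f t z = (\<lambda>x. if x \<in> closure U then f t x (z x) else 0)"


section \<open>Bochner integral and mild solutions\<close>

text \<open>
  The library's Bochner integral lives on second countable normed types, whereas the space here
  depends on \<open>U\<close>. The definition through simple functions is therefore repeated for a normed space
  \<open>V\<close> of functions; only the values of \<open>F\<close> outside a null set have to lie in \<open>V\<close>.
\<close>

definition simple_curve :: "('x \<Rightarrow> 'b) set \<Rightarrow> real \<Rightarrow> real \<Rightarrow> (real \<Rightarrow> 'x \<Rightarrow> 'b) \<Rightarrow> bool" where
  "simple_curve V a b s \<longleftrightarrow> s ` {a..b} \<subseteq> V \<and> finite (s ` {a..b}) \<and>
     (\<forall>v. {t \<in> {a..b}. s t = v} \<in> sets lebesgue)"

definition simple_curve_integral :: "real \<Rightarrow> real \<Rightarrow> (real \<Rightarrow> 'x \<Rightarrow> 'b::real_vector) \<Rightarrow> ('x \<Rightarrow> 'b)" where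
  "simple_curve_integral a b s =
     (\<lambda>x. \<Sum>v\<in>s ` {a..b}. measure lebesgue {t \<in> {a..b}. s t = v} *\<^sub>R v x)"

definition has_bochner_integral_on ::
  "('x \<Rightarrow> 'b::real_vector) set \<Rightarrow> (('x \<Rightarrow> 'b) \<Rightarrow> real) \<Rightarrow> real \<Rightarrow> real \<Rightarrow> (real \<Rightarrow> 'x \<Rightarrow> 'b) \<Rightarrow> ('x \<Rightarrow> 'b) \<Rightarrow> bool" where
  "has_bochner_integral_on V nrm a b F w \<longleftrightarrow> w \<in> V \<and>
     (AE t in lebesgue_on {a..b}. F t \<in> V) \<and>
     (\<exists>s. (\<forall>k::nat. simple_curve V a b (s k)) \<and>
          (\<forall>k. (\<lambda>t. nrm (F t - s k t)) \<in> borel_measurable (lebesgue_on {a..b})) \<and>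
          (\<lambda>k. \<integral>\<^sup>+ t. ennreal (nrm (F t - s k t)) \<partial>lebesgue_on {a..b}) \<longlonglongrightarrow> 0 \<and>
          (\<lambda>k. nrm (simple_curve_integral a b (s k) - w)) \<longlonglongrightarrow> 0)"

definition mild_solution ::
  "'x::topological_space set \<Rightarrow> ('x, 'n) bdry_cond \<Rightarrow> ('n::finite \<Rightarrow> real \<Rightarrow> ('x \<Rightarrow> real) \<Rightarrow> ('x \<Rightarrow> real)) \<Rightarrow>
   real \<Rightarrow> real \<Rightarrow> (real \<Rightarrow> 'x \<Rightarrow> real ^ 'n \<Rightarrow> real ^ 'n) \<Rightarrow> ('x \<Rightarrow> real ^ 'n) \<Rightarrow>
   (real \<Rightarrow> 'x \<Rightarrow> real ^ 'n) \<Rightarrow> bool" where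
  "mild_solution U bc S q1 q2 f z u \<longleftrightarrow>
     (\<forall>t\<in>{q1..q2}. u t \<in> bc_space U bc) \<and> cont_curve (normX U) {q1..q2} u \<and> u q1 = z \<and>
     (\<forall>t\<in>{q1..q2}. \<exists>w.
        has_bochner_integral_on (bc_space U bc) (normX U) q1 t
          (\<lambda>s. prod_semigroup S (t - s) (nemytskii U f s (u s))) w \<and>
        u t = prod_semigroup S (t - q1) z + w)"


section \<open>Moduli of continuity, radii and the sets \<open>K\<close>\<close>

definition rat_interval :: "real set \<Rightarrow> bool" where
  "rat_interval I \<longleftrightarrow> (\<exists>q1\<in>\<rat>. \<exists>q2\<in>\<rat>. q1 < q2 \<and> I = {q1..q2})"

definition modulus :: "(real \<Rightarrow> real) \<Rightarrow> bool" where
  "modulus \<theta> \<longleftrightarrow> continuous_on {0..} \<theta> \<and> \<theta> ` {0..} \<subseteq> {0..} \<and> mono_on {0..} \<theta> \<and> \<theta> 0 = 0"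

text \<open>
  \<open>\<theta>1 j I\<close> and \<open>\<theta>2 j I \<nu>\<close> are constrained, and used, only at indices \<open>j, \<nu> \<ge> 1\<close> and intervals \<open>I\<close>
  with rational endpoints, for \<open>\<theta>2\<close> of length greater than \<open>1 / \<nu>\<close>.
\<close>

definition suitable_moduli ::
  "(nat \<Rightarrow> real set \<Rightarrow> real \<Rightarrow> real) \<Rightarrow> (nat \<Rightarrow> real set \<Rightarrow> nat \<Rightarrow> real \<Rightarrow> real) \<Rightarrow> bool" where
  "suitable_moduli \<theta>1 \<theta>2 \<longleftrightarrow>
     (\<forall>j I. 1 \<le> j \<and> rat_interval I \<longrightarrow> modulus (\<theta>1 j I)) \<and>
     (\<forall>j I \<nu>. 1 \<le> j \<and> 1 \<le> \<nu> \<and> rat_interval I \<and> Inf I + 1 / real \<nu> < Sup I \<longrightarrow> modulus (\<theta>2 j I \<nu>)) \<and>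
     (\<forall>j1 j2 I1 I2. 1 \<le> j1 \<and> j1 \<le> j2 \<and> rat_interval I1 \<and> rat_interval I2 \<and> I1 \<subseteq> I2 \<longrightarrow>
        (\<forall>s\<ge>0. \<theta>1 j1 I1 s \<le> \<theta>1 j2 I2 s)) \<and>
     (\<forall>j1 j2 I1 I2 \<nu>1 \<nu>2. 1 \<le> j1 \<and> j1 \<le> j2 \<and> 1 \<le> \<nu>1 \<and> \<nu>1 \<le> \<nu>2 \<and>
        rat_interval I1 \<and> rat_interval I2 \<and> I1 \<subseteq> I2 \<and> Inf I1 + 1 / real \<nu>1 < Sup I1 \<longrightarrow>
        (\<forall>s\<ge>0. \<theta>2 j1 I1 \<nu>1 s \<le> \<theta>2 j2 I2 \<nu>2 s))"

definition suitable_radii :: "(nat \<Rightarrow> real set \<Rightarrow> real) \<Rightarrow> bool" where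
  "suitable_radii R \<longleftrightarrow>
     (\<forall>j I. 1 \<le> j \<and> rat_interval I \<longrightarrow> 0 < R j I) \<and>
     (\<forall>j1 j2 I1 I2. 1 \<le> j1 \<and> j1 \<le> j2 \<and> rat_interval I1 \<and> rat_interval I2 \<and> I1 \<subseteq> I2 \<longrightarrow>
        R j1 I1 \<le> R j2 I2)"

definition dist_to_set :: "(('x \<Rightarrow> 'b::ab_group_add) \<Rightarrow> real) \<Rightarrow> ('x \<Rightarrow> 'b) \<Rightarrow> ('x \<Rightarrow> 'b) set \<Rightarrow> real" where
  "dist_to_set nrm z F = (INF z'\<in>F. nrm (z - z'))"

definition K_set ::
  "'x::topological_space set \<Rightarrow> ('x, 'n) bdry_cond \<Rightarrow> ('n::finite \<Rightarrow> real \<Rightarrow> ('x \<Rightarrow> real) \<Rightarrow> ('x \<Rightarrow> real)) \<Rightarrow>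
   (nat \<Rightarrow> real set \<Rightarrow> real \<Rightarrow> real) \<Rightarrow> (nat \<Rightarrow> real set \<Rightarrow> nat \<Rightarrow> real \<Rightarrow> real) \<Rightarrow> (nat \<Rightarrow> real set \<Rightarrow> real) \<Rightarrow>
   nat \<Rightarrow> real set \<Rightarrow> (real \<Rightarrow> 'x \<Rightarrow> real ^ 'n) set" where
  "K_set U bc S \<theta>1 \<theta>2 R j I = {v.
     (\<forall>t\<in>I. v t \<in> cball_C U (real j)) \<and> cont_curve (normX U) I v \<and>
     (\<forall>r1\<in>\<rat>. \<forall>r2\<in>\<rat>. \<forall>\<nu>::nat. r1 < r2 \<and> {r1..r2} \<subseteq> I \<and> 1 \<le> \<nu> \<and> r1 + 1 / real \<nu> < r2 \<longrightarrow>
        (\<forall>t1\<in>{r1 + 1 / real \<nu>..r2}. \<forall>t2\<in>{r1 + 1 / real \<nu>..r2}.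
           normX U (v t1 - v t2) \<le> \<theta>2 j {r1..r2} \<nu> \<bar>t1 - t2\<bar> + \<theta>1 j {r1..r2} (1 / real \<nu>)) \<and>
        (\<forall>t\<in>{r1 + 1 / real \<nu>..r2}.
           dist_to_set (normX U) (v t)
             (prod_semigroup S (1 / real \<nu>) ` (cball_C U (R j {r1..r2}) \<inter> bc_space U bc))
           \<le> \<theta>1 j {r1..r2} (1 / real \<nu>)))}"

end

theory Submission
  imports Defs
begin

text \<open>
  Write \<open>P t\<close> for the semigroup on \<open>X\<close> and \<open>N\<close> for the number of components. Along a mild solution
  bounded by \<open>j\<close>, for \<open>t' \<le> t\<close>, the difference \<open>u t - P (t - t') (u t')\<close> is the Bochner integral of
  \<open>P (t - s)\<close> applied to the nonlinearity over \<open>[t', t]\<close>, so its norm is at most \<open>N\<close> times the integral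
  of an \<open>m\<close>-bound, hence at most \<open>N * \<Omega> (t - t')\<close> with a modulus \<open>\<Omega>\<close> depending only on \<open>E\<close>. This estimate is
  obtained by testing with evaluations of components, which turn Bochner integrals into Lebesgue
  integrals of real functions. With \<open>t' = t - 1/\<nu>\<close> it bounds the distance of \<open>u t\<close> from
  \<open>P (1/\<nu>)\<close> of the ball of radius \<open>j\<close>. For the oscillation, one adds the modulus \<open>\<eta>\<close> of
  \<open>\<sigma> \<mapsto> P \<sigma> (P \<tau> z)\<close> at \<open>0\<close>, uniform in \<open>\<tau> \<ge> 1/\<nu>\<close> and \<open>z\<close> in the unit ball; it tends to \<open>0\<close>
  because \<open>P (1/\<nu>)\<close> is compact. So \<open>\<theta>2 = j * \<eta> + N * \<Omega>\<close>, \<open>\<theta>1 = N * (N + 1) * \<Omega>\<close> and \<open>R = j\<close> do. Both \<open>\<Omega>\<close> and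
  \<open>\<eta>\<close> are suprema of quantities that are subadditive in the length of the time step, which makes
  them continuous as soon as they are small for small steps.
\<close>

section \<open>Functionals of Bochner integrals\<close>

text \<open>The curve takes finitely many values on \<open>{a..b}\<close>, so \<open>\<phi>\<close>
  composed with it is a finite combination of indicators of measurable sets of finite measure, and
  linearity carries \<open>\<phi>\<close> through the sum defining the integral.\<close>

lemma has_bochner_integral_simple_curve:
  fixes \<phi> :: "('x \<Rightarrow> 'b::real_vector) \<Rightarrow> real"
  assumes V0: "(\<lambda>x. 0) \<in> V"
    and Vadd: "\<And>v w. v \<in> V \<Longrightarrow> w \<in> V \<Longrightarrow> v + w \<in> V"
    and Vscale: "\<And>c v. v \<in> V \<Longrightarrow> (\<lambda>x. c *\<^sub>R v x) \<in> V"
    and add: "\<And>v w. v \<in> V \<Longrightarrow> w \<in> V \<Longrightarrow> \<phi> (v + w) = \<phi> v + \<phi> w"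
    and scale: "\<And>c v. v \<in> V \<Longrightarrow> \<phi> (\<lambda>x. c *\<^sub>R v x) = c * \<phi> v"
    and s: "simple_curve V a b s"
  shows "simple_curve_integral a b s \<in> V"
    and "Bochner_Integration.simple_bochner_integrable (lebesgue_on {a..b}) (\<lambda>t. \<phi> (s t))"
    and "has_bochner_integral (lebesgue_on {a..b}) (\<lambda>t. \<phi> (s t)) (\<phi> (simple_curve_integral a b s))"
proof -
  let ?M = "lebesgue_on {a..b}"
  define A where "A v = {t \<in> {a..b}. s t = v}" for v
  have sV: "s ` {a..b} \<subseteq> V" and fin: "finite (s ` {a..b})" and A: "A v \<in> sets lebesgue" for v
    using s unfolding simple_curve_def A_def by blast+
  have lm: "A v \<in> lmeasurable" for v
    using A by (rule fmeasurableI2[of "{a..b}", rotated 2]) (auto simp: A_def)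
  have phi0: "\<phi> (\<lambda>x. 0) = 0"
    using scale[OF V0, of 0] by simp
  \<comment> \<open>Membership and linearity go through one induction, because additivity of
    \<open>\<phi>\<close> is available only once the partial sum is known to lie in
    \<open>V\<close>.\<close>
  have sums: "(\<lambda>x. \<Sum>v\<in>F. c v *\<^sub>R v x) \<in> V \<and> \<phi> (\<lambda>x. \<Sum>v\<in>F. c v *\<^sub>R v x) = (\<Sum>v\<in>F. c v * \<phi> v)"
    if "finite F" "F \<subseteq> V" for F c
    using that
  proof (induction F)
    case empty
    then show ?case by (simp add: V0 phi0)
  next
    case (insert v F)
    have "(\<lambda>x. \<Sum>v\<in>insert v F. c v *\<^sub>R v x) = (\<lambda>x. c v *\<^sub>R v x) + (\<lambda>x. \<Sum>v\<in>F. c v *\<^sub>R v x)"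
      using insert by (auto simp: fun_eq_iff)
    with insert show ?case
      by (simp add: Vadd Vscale add scale)
  qed
  show "simple_curve_integral a b s \<in> V"
    unfolding simple_curve_integral_def by (rule sums[OF fin sV, THEN conjunct1])
  have int: "\<phi> (simple_curve_integral a b s) = (\<Sum>v\<in>s ` {a..b}. measure lebesgue (A v) * \<phi> v)"
    unfolding simple_curve_integral_def A_def by (rule sums[OF fin sV, THEN conjunct2])
  have "has_bochner_integral ?M (\<lambda>t. \<Sum>v\<in>s ` {a..b}. indicator (A v) t *\<^sub>R \<phi> v)
      (\<Sum>v\<in>s ` {a..b}. measure lebesgue (A v) *\<^sub>R \<phi> v)"
  proof (intro has_bochner_integral_sum has_bochner_integral_scaleR_left)
    fix v
    have "A v \<subseteq> {a..b}" by (auto simp: A_def)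
    then have "A v \<in> sets ?M" "emeasure ?M (A v) = emeasure lebesgue (A v)"
      using A[of v] by (auto simp: sets_restrict_space_iff emeasure_restrict_space)
    moreover have "emeasure lebesgue (A v) < \<infinity>"
      using lm[of v] by (metis fmeasurableD2 infinity_ennreal_def top.not_eq_extremum)
    ultimately have "has_bochner_integral ?M (indicator (A v)) (measure ?M (A v))"
      by (intro has_bochner_integral_real_indicator) auto
    moreover have "measure ?M (A v) = measure lebesgue (A v)"
      using \<open>emeasure ?M (A v) = _\<close> by (simp add: measure_def)
    ultimately show "has_bochner_integral ?M (indicator (A v)) (measure lebesgue (A v))"
      by simp
  qed
  moreover have "(\<Sum>v\<in>s ` {a..b}. indicator (A v) t *\<^sub>R \<phi> v) = \<phi> (s t)" if "t \<in> {a..b}" for t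
  proof -
    have "(\<Sum>v\<in>s ` {a..b}. indicator (A v) t *\<^sub>R \<phi> v) = (\<Sum>v\<in>s ` {a..b}. if v = s t then \<phi> v else 0)"
      using that by (intro sum.cong) (auto simp: A_def indicator_def)
    also have "\<dots> = \<phi> (s t)" using that fin by simp
    finally show ?thesis .
  qed
  ultimately show hb: "has_bochner_integral ?M (\<lambda>t. \<phi> (s t)) (\<phi> (simple_curve_integral a b s))"
    unfolding int by (subst has_bochner_integral_cong[where g="\<lambda>t. \<Sum>v\<in>s ` {a..b}. indicator (A v) t *\<^sub>R \<phi> v"]) auto
  have "simple_function ?M (\<lambda>t. \<phi> (s t))"
  proof (rule simple_function_borel_measurable)
    show "(\<lambda>t. \<phi> (s t)) \<in> borel_measurable ?M"
      using hb by (auto simp: has_bochner_integral_iff)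
    show "finite ((\<lambda>t. \<phi> (s t)) ` space ?M)"
      using finite_imageI[OF fin, of \<phi>] by (simp add: image_image)
  qed
  moreover have "emeasure ?M {t \<in> space ?M. \<phi> (s t) \<noteq> 0} \<noteq> \<infinity>"
  proof -
    have "emeasure ?M {t \<in> space ?M. \<phi> (s t) \<noteq> 0} \<le> emeasure ?M (space ?M)"
      by (rule emeasure_space)
    also have "\<dots> = ennreal (if a \<le> b then b - a else 0)"
      by (simp add: emeasure_restrict_space)
    finally show ?thesis by (auto simp: top_unique)
  qed
  ultimately show "Bochner_Integration.simple_bochner_integrable ?M (\<lambda>t. \<phi> (s t))"
    by (rule simple_bochner_integrable.intros)
qed

text \<open>The pointwise \<open>lim\<close> is measurable and agrees with \<open>f\<close> almost
  everywhere. Extending both by zero off \<open>S\<close> moves the comparison to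
  \<open>lebesgue\<close>, where completeness transfers measurability.\<close>

lemma borel_measurable_lebesgue_on_AE_LIMSEQ:
  fixes f :: "real \<Rightarrow> real"
  assumes S: "S \<in> sets lebesgue"
    and g: "\<And>k::nat. g k \<in> borel_measurable (lebesgue_on S)"
    and lim: "AE t in lebesgue_on S. (\<lambda>k. g k t) \<longlonglongrightarrow> f t"
  shows "f \<in> borel_measurable (lebesgue_on S)"
proof -
  let ?h = "\<lambda>t. if t \<in> S then lim (\<lambda>k. g k t) else 0"
  have "(\<lambda>t. lim (\<lambda>k. g k t)) \<in> borel_measurable (lebesgue_on S)"
    using g by (rule borel_measurable_lim_metric)
  then have "?h \<in> borel_measurable lebesgue"
    using S by (simp add: borel_measurable_if)
  moreover have "AE t in lebesgue. ?h t = (if t \<in> S then f t else 0)"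
    using lim S by (simp add: AE_restrict_space_iff) (auto elim!: eventually_mono simp: limI)
  ultimately have "(\<lambda>t. if t \<in> S then f t else 0) \<in> borel_measurable lebesgue"
    by (rule borel_measurable_AE)
  then show ?thesis
    using S by (simp add: borel_measurable_if)
qed

text \<open>Applying \<open>\<phi>\<close> to the approximating simple curves gives real simple
  functions whose L1 error is at most \<open>C\<close> times the original one, so the library's
  definition of the Bochner integral is met. Measurability of \<open>\<phi>\<close> along
  \<open>F\<close> is the part that needs an argument of its own.\<close>

proposition has_bochner_integral_on_functional:
  fixes \<phi> :: "('x \<Rightarrow> 'b::real_vector) \<Rightarrow> real"
  assumes V0: "(\<lambda>x. 0) \<in> V"
    and Vadd: "\<And>v w. v \<in> V \<Longrightarrow> w \<in> V \<Longrightarrow> v + w \<in> V"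
    and Vscale: "\<And>c v. v \<in> V \<Longrightarrow> (\<lambda>x. c *\<^sub>R v x) \<in> V"
    and add: "\<And>v w. v \<in> V \<Longrightarrow> w \<in> V \<Longrightarrow> \<phi> (v + w) = \<phi> v + \<phi> w"
    and scale: "\<And>c v. v \<in> V \<Longrightarrow> \<phi> (\<lambda>x. c *\<^sub>R v x) = c * \<phi> v"
    and bnd: "\<And>v. v \<in> V \<Longrightarrow> \<bar>\<phi> v\<bar> \<le> C * nrm v"
    and C: "0 \<le> C"
    and F: "has_bochner_integral_on V nrm a b F w"
  shows "has_bochner_integral (lebesgue_on {a..b}) (\<lambda>t. \<phi> (F t)) (\<phi> w)"
proof -
  let ?M = "lebesgue_on {a..b}"
  obtain s where wV: "w \<in> V" and FV: "AE t in ?M. F t \<in> V"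
    and s: "\<And>k::nat. simple_curve V a b (s k)"
    and meas: "\<And>k. (\<lambda>t. nrm (F t - s k t)) \<in> borel_measurable ?M"
    and L1: "(\<lambda>k. \<integral>\<^sup>+ t. ennreal (nrm (F t - s k t)) \<partial>?M) \<longlonglongrightarrow> 0"
    and lim: "(\<lambda>k. nrm (simple_curve_integral a b (s k) - w)) \<longlonglongrightarrow> 0"
    using F unfolding has_bochner_integral_on_def by blast
  have curve_in: "simple_curve_integral a b (s k) \<in> V"
    and curve_simple: "Bochner_Integration.simple_bochner_integrable ?M (\<lambda>t. \<phi> (s k t))"
    and curve_int: "has_bochner_integral ?M (\<lambda>t. \<phi> (s k t)) (\<phi> (simple_curve_integral a b (s k)))" for k
    by (rule has_bochner_integral_simple_curve[OF V0 Vadd Vscale add scale s]; assumption)+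
  have Vdiff: "v - v' \<in> V" and phi_diff: "\<phi> (v - v') = \<phi> v - \<phi> v'" if "v \<in> V" "v' \<in> V" for v v'
  proof -
    have eq: "v - v' = v + (\<lambda>x. (-1) *\<^sub>R v' x)" by (auto simp: fun_eq_iff)
    show "v - v' \<in> V" "\<phi> (v - v') = \<phi> v - \<phi> v'"
      unfolding eq using that by (auto simp: Vadd Vscale add scale simp del: scaleR_minus_left scaleR_minus1_left)
  qed
  have sV: "s k t \<in> V" if "t \<in> {a..b}" for k t
    using s[of k] that by (auto simp: simple_curve_def)
  \<comment> \<open>Nonnegativity of \<open>nrm\<close> is not among the assumptions. Truncating at
    0 leaves the \<open>ennreal\<close> integrals unchanged and makes \<open>e\<close> a genuine
    nonnegative error.\<close>
  define e where "e k t = max 0 (nrm (F t - s k t))" for k t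
  have e_meas[measurable]: "e k \<in> borel_measurable ?M" for k
    unfolding e_def using meas by measurable
  have e_nonneg: "0 \<le> e k t" for k t
    by (simp add: e_def)
  have e_L1: "(\<lambda>k. \<integral>\<^sup>+ t. ennreal (e k t) \<partial>?M) \<longlonglongrightarrow> 0"
    using L1 by (simp add: e_def ennreal_max_0)
  have bound: "AE t in ?M. \<forall>k. \<bar>\<phi> (F t) - \<phi> (s k t)\<bar> \<le> C * e k t"
    using FV AE_space
  proof eventually_elim
    case (elim t)
    show ?case
    proof
      fix k
      have "F t - s k t \<in> V" "\<phi> (F t - s k t) = \<phi> (F t) - \<phi> (s k t)"
        using elim sV[of t k] by (auto intro: Vdiff phi_diff)
      with bnd[of "F t - s k t"] C show "\<bar>\<phi> (F t) - \<phi> (s k t)\<bar> \<le> C * e k t"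
        by (smt (verit, best) e_def mult_left_mono)
    qed
  qed
  \<comment> \<open>The tail from \<open>k0\<close> on consists of integrable functions, as the
    passage to an almost everywhere convergent subsequence requires.\<close>
  have "eventually (\<lambda>k. (\<integral>\<^sup>+ t. ennreal (e k t) \<partial>?M) < 1) sequentially"
    using e_L1 by (rule order_tendstoD) simp
  then obtain k0 where k0: "\<And>k. k0 \<le> k \<Longrightarrow> (\<integral>\<^sup>+ t. ennreal (e k t) \<partial>?M) < 1"
    by (auto simp: eventually_sequentially)
  have e_int: "integrable ?M (e (k + k0))" for k
  proof -
    have "(\<integral>\<^sup>+ t. ennreal (e (k + k0) t) \<partial>?M) < \<infinity>"
      using k0[of "k + k0"] by (simp add: less_top[symmetric]) (metis ennreal_one_neq_top less_trans top.not_eq_extremum)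
    moreover have "AE t in ?M. 0 \<le> e (k + k0) t" by (rule AE_I2) (simp add: e_def)
    ultimately show ?thesis by (intro integrableI_nonneg e_meas)
  qed
  have "(\<lambda>k. \<integral>t. norm (e (k + k0) t) \<partial>?M) \<longlonglongrightarrow> 0"
  proof -
    have "(\<integral>t. norm (e (k + k0) t) \<partial>?M) = enn2real (\<integral>\<^sup>+ t. ennreal (e (k + k0) t) \<partial>?M)" for k
      by (subst integral_eq_nn_integral) (simp_all add: e_nonneg)
    moreover have "(\<lambda>k. enn2real (\<integral>\<^sup>+ t. ennreal (e (k + k0) t) \<partial>?M)) \<longlonglongrightarrow> 0"
    proof (rule tendsto_enn2real)
      show "(\<lambda>k. \<integral>\<^sup>+ t. ennreal (e (k + k0) t) \<partial>?M) \<longlonglongrightarrow> ennreal 0"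
        using LIMSEQ_ignore_initial_segment[OF e_L1, of k0] by (simp only: ennreal_0)
    qed simp
    ultimately show ?thesis by simp
  qed
  \<comment> \<open>Pointwise convergence is available only along a subsequence, which suffices for
    the measurability of \<open>\<phi> (F t)\<close>; the integrals below use the full
    sequence.\<close>
  from tendsto_L1_AE_subseq[OF e_int this] obtain r :: "nat \<Rightarrow> nat"
    where r: "AE t in ?M. (\<lambda>n. e (r n + k0) t) \<longlonglongrightarrow> 0" by blast
  have "AE t in ?M. (\<lambda>n. \<phi> (s (r n + k0) t)) \<longlonglongrightarrow> \<phi> (F t)"
    using r bound
  proof eventually_elim
    case (elim t)
    have "(\<lambda>n. C * e (r n + k0) t) \<longlonglongrightarrow> 0"
      using tendsto_mult_right_zero[OF elim(1)] .
    then have "(\<lambda>n. \<phi> (s (r n + k0) t) - \<phi> (F t)) \<longlonglongrightarrow> 0"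
      by (rule Lim_null_comparison[rotated]) (use elim(2) in \<open>auto simp: abs_minus_commute\<close>)
    then show ?case by (rule LIM_zero_cancel)
  qed
  then have phiF: "(\<lambda>t. \<phi> (F t)) \<in> borel_measurable ?M"
    by (rule borel_measurable_lebesgue_on_AE_LIMSEQ[rotated 2])
      (simp, rule borel_measurable_has_bochner_integral[OF curve_int])
  show ?thesis
  proof (rule has_bochner_integral.intros[OF phiF curve_simple])
    show "(\<lambda>k. \<integral>\<^sup>+ t. ennreal (norm (\<phi> (F t) - \<phi> (s k t))) \<partial>?M) \<longlonglongrightarrow> 0"
    proof (rule tendsto_sandwich[OF _ _ tendsto_const])
      show "\<forall>\<^sub>F k in sequentially. (\<integral>\<^sup>+ t. ennreal (norm (\<phi> (F t) - \<phi> (s k t))) \<partial>?M)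
          \<le> ennreal C * (\<integral>\<^sup>+ t. ennreal (e k t) \<partial>?M)"
      proof (rule always_eventually, rule allI)
        fix k
        have "(\<integral>\<^sup>+ t. ennreal (norm (\<phi> (F t) - \<phi> (s k t))) \<partial>?M) \<le> (\<integral>\<^sup>+ t. ennreal C * ennreal (e k t) \<partial>?M)"
        proof (rule nn_integral_mono_AE)
          show "AE t in ?M. ennreal (norm (\<phi> (F t) - \<phi> (s k t))) \<le> ennreal C * ennreal (e k t)"
            using bound by eventually_elim (simp add: ennreal_mult'[symmetric] C ennreal_leI)
        qed
        then show "(\<integral>\<^sup>+ t. ennreal (norm (\<phi> (F t) - \<phi> (s k t))) \<partial>?M)
            \<le> ennreal C * (\<integral>\<^sup>+ t. ennreal (e k t) \<partial>?M)"
          by (simp add: nn_integral_cmult)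
      qed
      show "(\<lambda>k. ennreal C * (\<integral>\<^sup>+ t. ennreal (e k t) \<partial>?M)) \<longlonglongrightarrow> 0"
        using ennreal_tendsto_cmult[OF _ e_L1, of "ennreal C"] by simp
    qed simp
    have "Bochner_Integration.simple_bochner_integral ?M (\<lambda>t. \<phi> (s k t)) = \<phi> (simple_curve_integral a b (s k))" for k
      using has_bochner_integral_simple_bochner_integrable[OF curve_simple] curve_int
      by (rule has_bochner_integral_eq)
    moreover have "(\<lambda>k. \<phi> (simple_curve_integral a b (s k)) - \<phi> w) \<longlonglongrightarrow> 0"
    proof (rule Lim_null_comparison)
      show "\<forall>\<^sub>F k in sequentially. norm (\<phi> (simple_curve_integral a b (s k)) - \<phi> w)
          \<le> C * nrm (simple_curve_integral a b (s k) - w)"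
        using bnd[OF Vdiff[OF curve_in wV]] phi_diff[OF curve_in wV] by simp
      show "(\<lambda>k. C * nrm (simple_curve_integral a b (s k) - w)) \<longlonglongrightarrow> 0"
        using tendsto_mult_right_zero[OF lim] .
    qed
    ultimately show "(\<lambda>k. Bochner_Integration.simple_bochner_integral ?M (\<lambda>t. \<phi> (s k t))) \<longlonglongrightarrow> \<phi> w"
      by (simp add: LIM_zero_cancel)
  qed
qed

section \<open>Moduli of subadditive families\<close>

text \<open>Pieces of length \<open>\<delta>\<close> are split off one at a time, each costing at
  most 1. The extra 1 pays for the remaining piece of length at most 0.\<close>

lemma subadditive_small_bounded:
  fixes len val :: "'p \<Rightarrow> real"
  assumes split: "\<And>p c d. p \<in> G \<Longrightarrow> 0 \<le> c \<Longrightarrow> 0 \<le> d \<Longrightarrow> len p \<le> c + d \<Longrightarrow>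
      \<exists>p1\<in>G. \<exists>p2\<in>G. len p1 \<le> c \<and> len p2 \<le> d \<and> val p \<le> val p1 + val p2"
    and \<delta>: "0 < \<delta>" "\<And>p. p \<in> G \<Longrightarrow> len p \<le> \<delta> \<Longrightarrow> val p \<le> 1"
    and "p \<in> G" "len p \<le> real n * \<delta>"
  shows "val p \<le> real n + 1"
  using assms(4,5)
proof (induction n arbitrary: p)
  case 0
  then show ?case using \<delta> by force
next
  case (Suc n)
  then obtain p1 p2 where "p1 \<in> G" "p2 \<in> G" "len p1 \<le> real n * \<delta>" "len p2 \<le> \<delta>" "val p \<le> val p1 + val p2"
    using split[of p "real n * \<delta>" \<delta>] \<delta>(1) by (auto simp: algebra_simps)
  then show ?case using Suc.IH[of p1] \<delta>(2)[of p2] by simp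
qed

text \<open>The element \<open>0\<close> is inserted because \<open>Sup {}\<close> is unspecified.\<close>

definition sup_modulus :: "'p set \<Rightarrow> ('p \<Rightarrow> real) \<Rightarrow> ('p \<Rightarrow> real) \<Rightarrow> real \<Rightarrow> real" where
  "sup_modulus G len val s = Sup (insert 0 (val ` {p \<in> G. len p \<le> s}))"

text \<open>Common frame for the two moduli of the proof: integrals of \<open>m\<close>-bounds
  measured by interval length, and increments of smoothed orbits measured by the time step.
  Splitting yields finite suprema and subadditivity, and smallness yields continuity at 0.\<close>

locale subadditive_family =
  fixes G :: "'p set" and len val :: "'p \<Rightarrow> real"
  assumes split: "\<And>p c d. p \<in> G \<Longrightarrow> 0 \<le> c \<Longrightarrow> 0 \<le> d \<Longrightarrow> len p \<le> c + d \<Longrightarrow>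
      \<exists>p1\<in>G. \<exists>p2\<in>G. len p1 \<le> c \<and> len p2 \<le> d \<and> val p \<le> val p1 + val p2"
    and small: "\<And>\<epsilon>. 0 < \<epsilon> \<Longrightarrow> \<exists>\<delta>>0. \<forall>p\<in>G. len p < \<delta> \<longrightarrow> val p \<le> \<epsilon>"
begin

lemma bdd: "bdd_above (insert 0 (val ` {p \<in> G. len p \<le> s}))"
proof -
  obtain \<delta> where \<delta>: "\<delta> > 0" "\<And>p. p \<in> G \<Longrightarrow> len p < \<delta> \<Longrightarrow> val p \<le> 1"
    using small[of 1] by auto
  \<comment> \<open>Half of \<open>\<delta>\<close> turns the strict inequality in the smallness
    condition into the weak one needed for counting steps.\<close>
  obtain n :: nat where n: "s \<le> real n * (\<delta> / 2)"
    using real_arch_simple[of "s / (\<delta> / 2)"] \<delta>(1) by (auto simp: field_simps)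
  have "val p \<le> real n + 1" if "p \<in> G" "len p \<le> s" for p
    by (rule subadditive_small_bounded[where \<delta>="\<delta>/2", OF split]) (use that n \<delta> in auto)
  then show ?thesis
    by (intro bdd_aboveI[of _ "real n + 1"]) auto
qed

lemma sup_modulus_ge: "p \<in> G \<Longrightarrow> len p \<le> s \<Longrightarrow> val p \<le> sup_modulus G len val s"
  unfolding sup_modulus_def by (intro cSup_upper bdd) auto

lemma sup_modulus_nonneg: "0 \<le> sup_modulus G len val s"
  unfolding sup_modulus_def by (intro cSup_upper bdd) auto

lemma sup_modulus_le:
  "0 \<le> C \<Longrightarrow> (\<And>p. p \<in> G \<Longrightarrow> len p \<le> s \<Longrightarrow> val p \<le> C) \<Longrightarrow> sup_modulus G len val s \<le> C"
  unfolding sup_modulus_def by (intro cSup_least) auto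

lemma sup_modulus_mono: "s \<le> t \<Longrightarrow> sup_modulus G len val s \<le> sup_modulus G len val t"
  by (rule sup_modulus_le[OF sup_modulus_nonneg]) (auto intro: sup_modulus_ge)

lemma sup_modulus_subadd:
  assumes "0 \<le> s" "0 \<le> t"
  shows "sup_modulus G len val (s + t) \<le> sup_modulus G len val s + sup_modulus G len val t"
proof (rule sup_modulus_le)
  fix p assume "p \<in> G" "len p \<le> s + t"
  with split[of p s t] assms obtain p1 p2 where "p1 \<in> G" "p2 \<in> G" "len p1 \<le> s" "len p2 \<le> t"
    "val p \<le> val p1 + val p2" by blast
  then show "val p \<le> sup_modulus G len val s + sup_modulus G len val t"
    using sup_modulus_ge[of p1 s] sup_modulus_ge[of p2 t] by linarith
qed (simp add: sup_modulus_nonneg)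

text \<open>Monotonicity and subadditivity bound the difference of two values by the value at the
  distance of the arguments, so smallness near 0 gives continuity everywhere. A positive value at 0
  would contradict smallness with that value as the tolerance.\<close>

lemma modulus_sup_modulus: "modulus (sup_modulus G len val)"
proof -
  let ?g = "sup_modulus G len val"
  have sm: "\<exists>\<delta>>0. \<forall>s<\<delta>. ?g s < \<epsilon>" if "\<epsilon> > 0" for \<epsilon>
  proof -
    obtain \<delta> where \<delta>: "\<delta> > 0" "\<And>p. p \<in> G \<Longrightarrow> len p < \<delta> \<Longrightarrow> val p \<le> \<epsilon> / 2"
      using small[of "\<epsilon> / 2"] \<open>\<epsilon> > 0\<close> by auto
    have "?g s \<le> \<epsilon> / 2" if "s < \<delta>" for s
      using \<delta> \<open>\<epsilon> > 0\<close> that by (intro sup_modulus_le) auto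
    moreover have "\<epsilon> / 2 < \<epsilon>" using \<open>\<epsilon> > 0\<close> by simp
    ultimately show ?thesis using \<delta>(1) by (meson le_less_trans)
  qed
  have g0: "?g 0 = 0"
  proof (rule ccontr)
    assume "?g 0 \<noteq> 0"
    then have "?g 0 > 0" using sup_modulus_nonneg[of 0] by simp
    from sm[OF this] show False by auto
  qed
  have diff: "\<bar>?g s - ?g t\<bar> \<le> ?g \<bar>s - t\<bar>" if "0 \<le> s" "0 \<le> t" for s t
  proof (cases "s \<le> t")
    case True
    then show ?thesis
      using sup_modulus_subadd[of s "t - s"] sup_modulus_mono[of s t] that by simp
  next
    case False
    then show ?thesis
      using sup_modulus_subadd[of t "s - t"] sup_modulus_mono[of t s] that by simp
  qed
  have "continuous_on {0..} ?g"
    unfolding continuous_on_iff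
  proof (intro ballI allI impI)
    fix t \<epsilon> :: real assume "t \<in> {0..}" "0 < \<epsilon>"
    with sm obtain \<delta> where "\<delta> > 0" "\<forall>s<\<delta>. ?g s < \<epsilon>" by blast
    then show "\<exists>\<delta>>0. \<forall>s\<in>{0..}. dist s t < \<delta> \<longrightarrow> dist (?g s) (?g t) < \<epsilon>"
      using diff[of _ t] \<open>t \<in> {0..}\<close>
      by (metis atLeast_iff dist_real_def le_less_trans)
  qed
  then show ?thesis
    unfolding modulus_def using g0 sup_modulus_nonneg sup_modulus_mono by (auto simp: mono_on_def)
qed

end

lemma sup_modulus_mono_family:
  assumes "subadditive_family G len val" "subadditive_family H len val" "G \<subseteq> H"
  shows "sup_modulus G len val s \<le> sup_modulus H len val s"
  by (rule subadditive_family.sup_modulus_le[OF assms(1)])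
    (use assms in \<open>auto intro: subadditive_family.sup_modulus_ge subadditive_family.sup_modulus_nonneg\<close>)

section \<open>Operations on moduli, and integrals over subintervals\<close>

lemma modulus_add: "modulus f \<Longrightarrow> modulus g \<Longrightarrow> modulus (\<lambda>s. f s + g s)"
  unfolding modulus_def mono_on_def
  by (auto intro!: continuous_intros add_mono simp: image_subset_iff)

lemma modulus_cmult: "0 \<le> c \<Longrightarrow> modulus f \<Longrightarrow> modulus (\<lambda>s. c * f s)"
  unfolding modulus_def mono_on_def
  by (auto intro!: continuous_intros mult_left_mono simp: image_subset_iff)

lemma modulus_sum: "(\<And>i. i \<in> A \<Longrightarrow> modulus (f i)) \<Longrightarrow> modulus (\<lambda>s. \<Sum>i\<in>A. f i s)"
  unfolding modulus_def mono_on_def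
  by (auto intro!: continuous_intros sum_mono sum_nonneg simp: image_subset_iff)

text \<open>Cutting an interval in two makes the integral additive, which gives the splitting.
  Smallness is the equicontinuity condition, since each integral lies below the extended-real
  supremum.\<close>

lemma subadditive_family_integrals:
  fixes M :: "(real \<Rightarrow> real) set"
  assumes L1: "\<And>m. m \<in> M \<Longrightarrow> m \<in> L1_loc"
    and equi: "\<And>r \<epsilon>. r > 0 \<Longrightarrow> \<epsilon> > 0 \<Longrightarrow> \<exists>\<delta>>0. \<forall>t1 t2. - r \<le> t1 \<and> t1 \<le> t2 \<and> t2 \<le> r \<and> t2 - t1 < \<delta> \<longrightarrow>
        (SUP m\<in>M. ereal (set_lebesgue_integral lebesgue {t1..t2} m)) < ereal \<epsilon>"
  shows "subadditive_family {(m, c, d). m \<in> M \<and> a \<le> c \<and> c \<le> d \<and> d \<le> b} (\<lambda>(m, c, d). d - c)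
    (\<lambda>(m, c, d). set_lebesgue_integral lebesgue {c..d} m)"
proof
  have int: "set_integrable lebesgue {c..d} m" if "m \<in> M" for m c d
    using L1[OF that] by (simp add: L1_loc_def)
  fix p :: "(real \<Rightarrow> real) \<times> real \<times> real" and u v :: real
  assume p: "p \<in> {(m, c, d). m \<in> M \<and> a \<le> c \<and> c \<le> d \<and> d \<le> b}" and uv: "0 \<le> u" "0 \<le> v"
    and "(case p of (m, c, d) \<Rightarrow> d - c) \<le> u + v"
  then obtain m c d where pm: "p = (m, c, d)" and mcd: "m \<in> M" "a \<le> c" "c \<le> d" "d \<le> b" "d - c \<le> u + v"
    by auto
  \<comment> \<open>The left piece uses as much of the allowed length \<open>u\<close> as the
    interval contains; what remains has length at most \<open>v\<close>.\<close>
  define e where "e = min d (c + u)"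
  have e: "c \<le> e" "e \<le> d" "e - c \<le> u" "d - e \<le> v"
    using mcd uv by (auto simp: e_def min_def)
  have "set_lebesgue_integral lebesgue {c..d} m
      = set_lebesgue_integral lebesgue {c..e} m + set_lebesgue_integral lebesgue {e..d} m"
    using Henstock_Kurzweil_Integration.integral_combine[OF e(1,2), of m] int[OF mcd(1)]
    by (simp add: set_lebesgue_integral_eq_integral)
  then show "\<exists>p1\<in>{(m, c, d). m \<in> M \<and> a \<le> c \<and> c \<le> d \<and> d \<le> b}.
      \<exists>p2\<in>{(m, c, d). m \<in> M \<and> a \<le> c \<and> c \<le> d \<and> d \<le> b}.
        (case p1 of (m, c, d) \<Rightarrow> d - c) \<le> u \<and> (case p2 of (m, c, d) \<Rightarrow> d - c) \<le> v \<and>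
        (case p of (m, c, d) \<Rightarrow> set_lebesgue_integral lebesgue {c..d} m)
          \<le> (case p1 of (m, c, d) \<Rightarrow> set_lebesgue_integral lebesgue {c..d} m) +
             (case p2 of (m, c, d) \<Rightarrow> set_lebesgue_integral lebesgue {c..d} m)"
    using e mcd pm by (intro bexI[of _ "(m, c, e)"] bexI[of _ "(m, e, d)"]) auto
next
  fix \<epsilon> :: real assume "0 < \<epsilon>"
  \<comment> \<open>Equicontinuity is stated on symmetric intervals, so \<open>{a..b}\<close> is
    placed inside one; the added 1 ensures a positive radius.\<close>
  define r where "r = max \<bar>a\<bar> \<bar>b\<bar> + 1"
  have "r > 0" by (auto simp: r_def)
  from equi[OF this \<open>0 < \<epsilon>\<close>] obtain \<delta> where \<delta>: "\<delta> > 0"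
    "\<And>t1 t2. - r \<le> t1 \<Longrightarrow> t1 \<le> t2 \<Longrightarrow> t2 \<le> r \<Longrightarrow> t2 - t1 < \<delta> \<Longrightarrow>
        (SUP m\<in>M. ereal (set_lebesgue_integral lebesgue {t1..t2} m)) < ereal \<epsilon>" by blast
  have "set_lebesgue_integral lebesgue {c..d} m \<le> \<epsilon>"
    if "m \<in> M" "a \<le> c" "c \<le> d" "d \<le> b" "d - c < \<delta>" for m c d
  proof -
    have "ereal (set_lebesgue_integral lebesgue {c..d} m)
        \<le> (SUP m\<in>M. ereal (set_lebesgue_integral lebesgue {c..d} m))"
      using that by (intro SUP_upper)
    also have "\<dots> < ereal \<epsilon>"
      using that by (intro \<delta>) (auto simp: r_def)
    finally show ?thesis by simp
  qed
  then show "\<exists>\<delta>>0. \<forall>p\<in>{(m, c, d). m \<in> M \<and> a \<le> c \<and> c \<le> d \<and> d \<le> b}.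
      (case p of (m, c, d) \<Rightarrow> d - c) < \<delta> \<longrightarrow>
      (case p of (m, c, d) \<Rightarrow> set_lebesgue_integral lebesgue {c..d} m) \<le> \<epsilon>"
    using \<delta>(1) by (intro exI[of _ \<delta>]) auto
qed

section \<open>Products of compact contraction semigroups\<close>

lemma norm1_nonneg: "0 \<le> norm1 y"
  by (simp add: norm1_def sum_nonneg)

lemma norm1_triangle: "norm1 (y + z) \<le> norm1 y + norm1 z"
  unfolding norm1_def sum.distrib[symmetric] by (intro sum_mono) (simp add: abs_triangle_ineq)

lemma norm1_scaleR: "norm1 (c *\<^sub>R y) = \<bar>c\<bar> * norm1 y"
  by (simp add: norm1_def abs_mult sum_distrib_left)

lemma component_le_norm1: "\<bar>y $ i\<bar> \<le> norm1 y"
  unfolding norm1_def by (rule member_le_sum) auto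

lemma continuous_on_norm1: "continuous_on A norm1"
  unfolding norm1_def by (intro continuous_intros)

text \<open>The closure of a bounded set is compact here, so the values of \<open>p\<close> along
  \<open>z\<close> are bounded above and the real \<open>SUP\<close> is a true upper bound.\<close>

lemma sup_norm_upper:
  fixes U :: "'x::heine_borel set"
  assumes "bounded U" "continuous_on UNIV p" "z \<in> Cbar U" "x \<in> closure U"
  shows "p (z x) \<le> sup_norm U p z"
proof -
  have "compact ((\<lambda>x. p (z x)) ` closure U)"
    using assms by (intro compact_continuous_image continuous_on_compose2[OF assms(2)])
      (auto simp: Cbar_def compact_closure)
  then have "bdd_above ((\<lambda>x. p (z x)) ` closure U)"
    by (intro bounded_imp_bdd_above compact_imp_bounded)
  then show ?thesis
    unfolding sup_norm_def using assms(4) by (rule cSUP_upper[rotated])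
qed

lemma sup_norm_least:
  assumes "U \<noteq> {}" "\<And>x. x \<in> closure U \<Longrightarrow> p (z x) \<le> C"
  shows "sup_norm U p z \<le> C"
  unfolding sup_norm_def using assms by (intro cSUP_least) auto

lemma bc_space_imp_Cbar: "z \<in> bc_space U bc \<Longrightarrow> z \<in> Cbar U"
  by (simp add: bc_space_def)

lemma bc_space_zero: "(\<lambda>x. 0) \<in> bc_space U bc"
  by (simp add: bc_space_def Cbar_def)

lemma bc_space_add:
  fixes z w :: "'x::topological_space \<Rightarrow> 'b::topological_monoid_add"
  shows "z \<in> bc_space U bc \<Longrightarrow> w \<in> bc_space U bc \<Longrightarrow> z + w \<in> bc_space U bc"
  by (auto simp: bc_space_def Cbar_def plus_fun_def intro: continuous_on_add)

lemma bc_space_scaleR: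
  fixes z :: "'x::topological_space \<Rightarrow> 'b::real_normed_vector"
  shows "z \<in> bc_space U bc \<Longrightarrow> (\<lambda>x. c *\<^sub>R z x) \<in> bc_space U bc"
  by (auto simp: bc_space_def Cbar_def intro!: continuous_intros)

lemma bc_space_diff:
  fixes z w :: "'x::topological_space \<Rightarrow> 'b::real_normed_vector"
  shows "z \<in> bc_space U bc \<Longrightarrow> w \<in> bc_space U bc \<Longrightarrow> z - w \<in> bc_space U bc"
  by (auto simp: bc_space_def Cbar_def fun_diff_def intro: continuous_on_diff)

lemma bc_space_component:
  fixes z :: "'x::topological_space \<Rightarrow> real ^ 'n"
  shows "z \<in> bc_space U bc \<Longrightarrow> (\<lambda>x. z x $ i) \<in> bc_space U bc"
  by (auto simp: bc_space_def Cbar_def intro!: continuous_intros)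

lemma bc_space_vec:
  fixes z :: "'n::finite \<Rightarrow> 'x::topological_space \<Rightarrow> real"
  shows "(\<And>i. z i \<in> bc_space U bc) \<Longrightarrow> (\<lambda>x. \<chi> i. z i x) \<in> bc_space U bc"
  by (auto simp: bc_space_def Cbar_def vec_eq_iff intro!: continuous_on_vec_lambda)

locale compact_contraction_semigroups =
  fixes U :: "'x::heine_borel set" and bc :: "('x, 'n::finite) bdry_cond"
    and S :: "'n \<Rightarrow> real \<Rightarrow> ('x \<Rightarrow> real) \<Rightarrow> ('x \<Rightarrow> real)"
  assumes nonempty: "U \<noteq> {}" and bounded: "bounded U"
    and semigroup: "\<And>i. C0_semigroup (bc_space U bc) (normY U) (S i)"
    and compact: "\<And>i t. 0 < t \<Longrightarrow> compact_op (bc_space U bc) (normY U) (S i t)"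
    and op_norm_le_1: "\<And>i t. 0 \<le> t \<Longrightarrow> op_norm (bc_space U bc) (normY U) (S i t) \<le> 1"
begin

abbreviation "Y \<equiv> (bc_space U bc :: ('x \<Rightarrow> real) set)"
abbreviation "X \<equiv> (bc_space U bc :: ('x \<Rightarrow> real ^ 'n) set)"
abbreviation "N \<equiv> real CARD('n)"
abbreviation "P \<equiv> prod_semigroup S"

lemma normY_upper: "z \<in> Y \<Longrightarrow> x \<in> closure U \<Longrightarrow> \<bar>z x\<bar> \<le> normY U z"
  using sup_norm_upper[OF bounded, of norm z x] bc_space_imp_Cbar[of z U bc]
  by (simp add: continuous_on_rabs continuous_on_id)

lemma normX_upper: "z \<in> X \<Longrightarrow> x \<in> closure U \<Longrightarrow> norm1 (z x) \<le> normX U z"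
  using sup_norm_upper[OF bounded continuous_on_norm1, of z x] bc_space_imp_Cbar[of z U bc] by blast

lemma closure_nonempty: "\<exists>x. x \<in> closure U"
  using nonempty by auto

lemma normY_least: "(\<And>x. x \<in> closure U \<Longrightarrow> \<bar>z x\<bar> \<le> C) \<Longrightarrow> normY U z \<le> C" for z :: "'x \<Rightarrow> real"
  using sup_norm_least[OF nonempty, of norm z C] by simp

lemma normX_least: "(\<And>x. x \<in> closure U \<Longrightarrow> norm1 (z x) \<le> C) \<Longrightarrow> normX U z \<le> C"
  using sup_norm_least[OF nonempty, of norm1 z C] .

lemma normY_nonneg: "z \<in> Y \<Longrightarrow> 0 \<le> normY U z"
  using normY_upper closure_nonempty abs_ge_zero order_trans by metis

lemma normX_nonneg: "z \<in> X \<Longrightarrow> 0 \<le> normX U z"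
  using normX_upper closure_nonempty norm1_nonneg order_trans by metis

lemma normY_triangle:
  assumes "z \<in> Y" "w \<in> Y"
  shows "normY U (z + w) \<le> normY U z + normY U w"
proof (rule normY_least)
  fix x assume "x \<in> closure U"
  then show "\<bar>(z + w) x\<bar> \<le> normY U z + normY U w"
    using normY_upper[OF assms(1), of x] normY_upper[OF assms(2), of x] by simp
qed

lemma normX_triangle:
  assumes "z \<in> X" "w \<in> X"
  shows "normX U (z + w) \<le> normX U z + normX U w"
proof (rule normX_least)
  fix x assume "x \<in> closure U"
  then show "norm1 ((z + w) x) \<le> normX U z + normX U w"
    using normX_upper[OF assms(1), of x] normX_upper[OF assms(2), of x] norm1_triangle[of "z x" "w x"] by simp
qed

lemma normX_minus_commute: "normX U (z - w) = normX U (w - z)"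
  by (simp add: sup_norm_def norm1_def abs_minus_commute)

lemma normY_minus_commute: "normY U (z - w) = normY U (w - z)" for z w :: "'x \<Rightarrow> real"
  by (simp add: sup_norm_def abs_minus_commute)

lemma normY_scale_le:
  assumes "z \<in> Y"
  shows "normY U (\<lambda>x. c *\<^sub>R z x) \<le> \<bar>c\<bar> * normY U z"
  using normY_upper[OF assms] by (intro normY_least) (simp add: abs_mult mult_left_mono)

lemma normX_scale_le:
  assumes "z \<in> X"
  shows "normX U (\<lambda>x. c *\<^sub>R z x) \<le> \<bar>c\<bar> * normX U z"
  using normX_upper[OF assms] by (intro normX_least) (simp add: norm1_scaleR mult_left_mono)

lemma normY_component:
  assumes "z \<in> X"
  shows "normY U (\<lambda>x. z x $ i) \<le> normX U z"
  using normX_upper[OF assms] component_le_norm1 order_trans by (intro normY_least) blast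

lemma normX_le_sum:
  assumes "z \<in> X"
  shows "normX U z \<le> (\<Sum>i\<in>UNIV. normY U (\<lambda>x. z x $ i))"
  unfolding norm1_def
  using normY_upper[OF bc_space_component[OF assms]]
  by (intro normX_least[unfolded norm1_def] sum_mono) auto

section \<open>The component semigroups on \<open>Y\<close>\<close>

lemma S_bdd_linear: "0 \<le> t \<Longrightarrow> bdd_linear_on Y (normY U) (S i t)"
  using semigroup[of i] unfolding C0_semigroup_def by blast

lemma S_in: "0 \<le> t \<Longrightarrow> z \<in> Y \<Longrightarrow> S i t z \<in> Y"
  using S_bdd_linear unfolding bdd_linear_on_def by blast

lemma S_add: "0 \<le> t \<Longrightarrow> z \<in> Y \<Longrightarrow> w \<in> Y \<Longrightarrow> S i t (z + w) = S i t z + S i t w"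
  using S_bdd_linear unfolding bdd_linear_on_def by blast

lemma S_scale: "0 \<le> t \<Longrightarrow> z \<in> Y \<Longrightarrow> S i t (\<lambda>x. c *\<^sub>R z x) = (\<lambda>x. c *\<^sub>R S i t z x)"
  using S_bdd_linear unfolding bdd_linear_on_def by blast

lemma S_zero: "z \<in> Y \<Longrightarrow> S i 0 z = z"
  using semigroup[of i] unfolding C0_semigroup_def by blast

lemma S_comp: "0 \<le> s \<Longrightarrow> 0 \<le> t \<Longrightarrow> z \<in> Y \<Longrightarrow> S i (s + t) z = S i s (S i t z)"
  using semigroup[of i] unfolding C0_semigroup_def by blast

lemma S_diff:
  assumes "0 \<le> t" "z \<in> Y" "w \<in> Y"
  shows "S i t (z - w) = S i t z - S i t w"
proof -
  have "S i t ((z - w) + w) = S i t (z - w) + S i t w"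
    using assms by (intro S_add bc_space_diff)
  then show ?thesis by (simp add: algebra_simps)
qed

text \<open>The hypothesis bounds a supremum over the unit ball; rescaling \<open>z\<close> to norm
  1 turns it into an estimate for every \<open>z\<close>.\<close>

lemma S_contraction:
  assumes t: "0 \<le> t" and z: "z \<in> Y"
  shows "normY U (S i t z) \<le> normY U z"
proof -
  obtain C where C: "\<And>z. z \<in> Y \<Longrightarrow> normY U (S i t z) \<le> C * normY U z"
    using S_bdd_linear[OF t] unfolding bdd_linear_on_def by blast
  consider "normY U z = 0" | "0 < normY U z" using normY_nonneg[OF z] by linarith
  then show ?thesis
  proof cases
    case 1
    with C[OF z] show ?thesis by simp
  next
    case 2
    define c where "c = 1 / normY U z"
    define y where "y = (\<lambda>x. c *\<^sub>R z x)"
    have y: "y \<in> Y" unfolding y_def using z by (rule bc_space_scaleR)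
    have y1: "normY U y \<le> 1"
      using normY_scale_le[OF z, of c] 2 by (simp add: y_def c_def)
    \<comment> \<open>A real \<open>SUP\<close> dominates its members only over a bounded set, so
      the a priori operator bound \<open>C\<close> is used first.\<close>
    have "bdd_above ((\<lambda>z. normY U (S i t z)) ` {z \<in> Y. normY U z \<le> 1})"
    proof (rule bdd_aboveI2[of _ _ "\<bar>C\<bar>"])
      fix z assume "z \<in> {z \<in> Y. normY U z \<le> 1}"
      with C[of z] normY_nonneg[of z] show "normY U (S i t z) \<le> \<bar>C\<bar>"
        by (smt (verit, best) mem_Collect_eq mult_left_le mult_right_mono)
    qed
    then have "normY U (S i t y) \<le> op_norm Y (normY U) (S i t)"
      unfolding op_norm_def using y y1 by (intro cSUP_upper) auto
    then have Sy: "normY U (S i t y) \<le> 1" using op_norm_le_1[OF t, of i] by linarith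
    have z_eq: "z = (\<lambda>x. normY U z *\<^sub>R y x)"
      using 2 by (simp add: y_def c_def)
    have "S i t z = (\<lambda>x. normY U z *\<^sub>R S i t y x)"
      by (subst z_eq) (rule S_scale[OF t y])
    then have "normY U (S i t z) \<le> \<bar>normY U z\<bar> * normY U (S i t y)"
      using normY_scale_le[OF S_in[OF t y]] by metis
    also have "\<dots> \<le> normY U z"
      using mult_left_mono[OF Sy, of "\<bar>normY U z\<bar>"] 2 by simp
    finally show ?thesis .
  qed
qed

text \<open>Otherwise there are steps tending to 0 and states in the unit ball with increments above
  \<open>\<epsilon>\<close>. By compactness a subsequence of the smoothed states converges to some
  \<open>w\<close>; strong continuity at \<open>w\<close> and contractivity then contradict the
  lower bound.\<close>

lemma S_uniformly_continuous:
  assumes \<tau>: "0 < \<tau>" and \<epsilon>: "0 < \<epsilon>"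
  shows "\<exists>\<delta>>0. \<forall>\<sigma> z. 0 \<le> \<sigma> \<and> \<sigma> < \<delta> \<and> z \<in> Y \<and> normY U z \<le> 1 \<longrightarrow>
    normY U (S i \<sigma> (S i \<tau> z) - S i \<tau> z) \<le> \<epsilon>"
proof (rule ccontr)
  assume neg: "\<not> ?thesis"
  have "\<exists>\<sigma> z. 0 \<le> \<sigma> \<and> \<sigma> < inverse (real (Suc k)) \<and> z \<in> Y \<and> normY U z \<le> 1 \<and>
      \<epsilon> < normY U (S i \<sigma> (S i \<tau> z) - S i \<tau> z)" for k
    using neg by (meson inverse_positive_iff_positive not_le of_nat_0_less_iff zero_less_Suc)
  then obtain \<sigma> z where \<sigma>: "\<And>k. 0 \<le> \<sigma> k" "\<And>k. \<sigma> k < inverse (real (Suc k))"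
    and z: "\<And>k. z k \<in> Y" "\<And>k. normY U (z k) \<le> 1"
    and far: "\<And>k. \<epsilon> < normY U (S i (\<sigma> k) (S i \<tau> (z k)) - S i \<tau> (z k))"
    by metis
  obtain w r where w: "w \<in> Y" and r: "strict_mono (r :: nat \<Rightarrow> nat)"
    and conv: "(\<lambda>k. normY U (S i \<tau> (z (r k)) - w)) \<longlonglongrightarrow> 0"
    using compact[OF \<tau>, of i] z unfolding compact_op_def by blast
  have "((\<lambda>t. normY U (S i t w - w)) \<longlongrightarrow> 0) (at_right 0)"
    using semigroup[of i] w unfolding C0_semigroup_def by blast
  then have "eventually (\<lambda>t. normY U (S i t w - w) < \<epsilon> / 3) (at_right 0)"
    by (rule order_tendstoD) (use \<epsilon> in simp)
  then obtain d where d: "0 < d" "\<And>t. 0 < t \<Longrightarrow> t < d \<Longrightarrow> normY U (S i t w - w) < \<epsilon> / 3"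
    by (auto simp: eventually_at_right_field)
  have "eventually (\<lambda>k. normY U (S i \<tau> (z (r k)) - w) < \<epsilon> / 3) sequentially"
    using conv by (rule order_tendstoD) (use \<epsilon> in simp)
  moreover have "eventually (\<lambda>k. inverse (real (Suc (r k))) < d) sequentially"
    using LIMSEQ_subseq_LIMSEQ[OF LIMSEQ_inverse_real_of_nat r] d(1)
    by (intro order_tendstoD(2)[of _ 0]) (auto simp: o_def)
  ultimately have "eventually (\<lambda>k. normY U (S i \<tau> (z (r k)) - w) < \<epsilon> / 3 \<and> inverse (real (Suc (r k))) < d) sequentially"
    by (rule eventually_conj)
  then obtain k where k: "normY U (S i \<tau> (z (r k)) - w) < \<epsilon> / 3" "inverse (real (Suc (r k))) < d"
    unfolding eventually_sequentially by blast
  define a where "a = S i \<tau> (z (r k))"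
  define s where "s = \<sigma> (r k)"
  have a: "a \<in> Y" unfolding a_def using \<tau> z(1) by (intro S_in) auto
  have s: "0 \<le> s" "s < d"
    using \<sigma>[of "r k"] k(2) by (auto simp: s_def)
  \<comment> \<open>Strong continuity is a limit along \<open>at_right 0\<close>, which says nothing
    about a step equal to 0.\<close>
  have "normY U (S i s w - w) < \<epsilon> / 3"
  proof (cases "s = 0")
    case True
    then have "normY U (S i s w - w) \<le> 0"
      using w by (intro normY_least) (simp add: S_zero)
    then show ?thesis using \<epsilon> by simp
  qed (use d s in auto)
  moreover have "normY U (S i s (a - w)) < \<epsilon> / 3"
    using S_contraction[OF s(1) bc_space_diff[OF a w], of i] k(1) by (simp add: a_def)
  moreover have "normY U (S i s a - a)
      \<le> normY U (S i s (a - w)) + (normY U (S i s w - w) + normY U (w - a))"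
  proof -
    \<comment> \<open>Each of the three terms is below \<open>\<epsilon> / 3\<close>: the first by
      contractivity and closeness of \<open>a\<close> to \<open>w\<close>, the second by continuity
      at \<open>w\<close>, the third by closeness again.\<close>
    have "S i s a - a = S i s (a - w) + ((S i s w - w) + (w - a))"
      by (simp add: S_diff[OF s(1) a w])
    moreover have "normY U (S i s (a - w) + ((S i s w - w) + (w - a)))
        \<le> normY U (S i s (a - w)) + (normY U (S i s w - w) + normY U (w - a))"
      using a w s
      by (intro order_trans[OF normY_triangle] add_left_mono normY_triangle bc_space_add bc_space_diff S_in) auto
    ultimately show ?thesis by (simp only:)
  qed
  ultimately have "normY U (S i s a - a) < \<epsilon>"
    using k(1) normY_minus_commute[of w a] unfolding a_def by linarith
  with far[of "r k"] show False by (simp add: a_def s_def)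
qed

section \<open>The product semigroup on \<open>X\<close>\<close>

lemma P_component: "P t z x $ i = S i t (\<lambda>y. z y $ i) x"
  by (simp add: prod_semigroup_def)

lemma P_in: "0 \<le> t \<Longrightarrow> z \<in> X \<Longrightarrow> P t z \<in> X"
  unfolding prod_semigroup_def by (intro bc_space_vec S_in bc_space_component)

lemma P_add:
  assumes "0 \<le> t" "z \<in> X" "w \<in> X"
  shows "P t (z + w) = P t z + P t w"
proof -
  have "S i t (\<lambda>y. (z + w) y $ i) = S i t (\<lambda>y. z y $ i) + S i t (\<lambda>y. w y $ i)" for i
    using S_add[OF assms(1) bc_space_component[OF assms(2)] bc_space_component[OF assms(3)], of i i i]
    by (simp add: plus_fun_def)
  then show ?thesis by (auto simp: fun_eq_iff vec_eq_iff P_component)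
qed

lemma P_diff:
  assumes "0 \<le> t" "z \<in> X" "w \<in> X"
  shows "P t (z - w) = P t z - P t w"
proof -
  have "P t ((z - w) + w) = P t (z - w) + P t w"
    using assms by (intro P_add bc_space_diff)
  then show ?thesis by (simp add: algebra_simps)
qed

lemma P_scale:
  assumes "0 \<le> t" "z \<in> X"
  shows "P t (\<lambda>x. c *\<^sub>R z x) = (\<lambda>x. c *\<^sub>R P t z x)"
  using S_scale[OF assms(1) bc_space_component[OF assms(2)]]
  by (simp add: fun_eq_iff vec_eq_iff P_component)

lemma P_comp:
  assumes "0 \<le> s" "0 \<le> t" "z \<in> X"
  shows "P (s + t) z = P s (P t z)"
  using S_comp[OF assms(1,2) bc_space_component[OF assms(3)]]
  by (simp add: fun_eq_iff vec_eq_iff P_component)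

text \<open>The factor is the number of components: \<open>norm1\<close> adds them, and each one
  evolves by a contraction.\<close>

lemma P_norm:
  assumes "0 \<le> t" "z \<in> X"
  shows "normX U (P t z) \<le> real CARD('n) * normX U z"
proof -
  have "normX U (P t z) \<le> (\<Sum>i\<in>UNIV. normY U (\<lambda>x. P t z x $ i))"
    using P_in[OF assms] by (rule normX_le_sum)
  also have "\<dots> \<le> (\<Sum>i\<in>(UNIV::'n set). normX U z)"
    unfolding P_component
    by (intro sum_mono order_trans[OF S_contraction normY_component] assms bc_space_component)
  finally show ?thesis by simp
qed

text \<open>Uniformity in \<open>\<tau>\<close> reduces to the single time \<open>\<tau>0\<close>:
  the earlier evolution over \<open>\<tau> - \<tau>0\<close> keeps each component in the unit ball.
  The tolerance is shared among the components, and the least of finitely many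
  \<open>\<delta> i\<close> serves for all.\<close>

lemma P_uniformly_continuous:
  assumes \<tau>0: "0 < \<tau>0" and \<epsilon>: "0 < \<epsilon>"
  shows "\<exists>\<delta>>0. \<forall>\<sigma> \<tau> z. 0 \<le> \<sigma> \<and> \<sigma> < \<delta> \<and> \<tau>0 \<le> \<tau> \<and> z \<in> X \<and> normX U z \<le> 1 \<longrightarrow>
    normX U (P \<sigma> (P \<tau> z) - P \<tau> z) \<le> \<epsilon>"
proof -
  have "\<forall>i. \<exists>\<delta>>0. \<forall>\<sigma> z. 0 \<le> \<sigma> \<and> \<sigma> < \<delta> \<and> z \<in> Y \<and> normY U z \<le> 1 \<longrightarrow>
      normY U (S i \<sigma> (S i \<tau>0 z) - S i \<tau>0 z) \<le> \<epsilon> / real CARD('n)"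
    using S_uniformly_continuous[OF \<tau>0, of "\<epsilon> / real CARD('n)"] \<epsilon> by simp
  then obtain \<delta> where \<delta>: "\<And>i. 0 < \<delta> i"
    and \<delta>': "\<And>i \<sigma> z. 0 \<le> \<sigma> \<Longrightarrow> \<sigma> < \<delta> i \<Longrightarrow> z \<in> Y \<Longrightarrow> normY U z \<le> 1 \<Longrightarrow>
      normY U (S i \<sigma> (S i \<tau>0 z) - S i \<tau>0 z) \<le> \<epsilon> / real CARD('n)"
    by metis
  have "normX U (P \<sigma> (P \<tau> z) - P \<tau> z) \<le> \<epsilon>"
    if "0 \<le> \<sigma>" "\<sigma> < Min (range \<delta>)" "\<tau>0 \<le> \<tau>" "z \<in> X" "normX U z \<le> 1" for \<sigma> \<tau> z
  proof -
    have "P \<sigma> (P \<tau> z) - P \<tau> z \<in> X"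
      using that \<tau>0 by (intro bc_space_diff P_in) auto
    then have "normX U (P \<sigma> (P \<tau> z) - P \<tau> z)
        \<le> (\<Sum>i\<in>UNIV. normY U (\<lambda>x. (P \<sigma> (P \<tau> z) - P \<tau> z) x $ i))"
      by (rule normX_le_sum)
    also have "\<dots> \<le> (\<Sum>i\<in>(UNIV::'n set). \<epsilon> / real CARD('n))"
    proof (rule sum_mono)
      fix i
      let ?y = "S i (\<tau> - \<tau>0) (\<lambda>x. z x $ i)"
      have zi: "(\<lambda>x. z x $ i) \<in> Y" using that by (intro bc_space_component)
      have "?y \<in> Y" "normY U ?y \<le> 1"
        using that zi S_contraction[of "\<tau> - \<tau>0" "\<lambda>x. z x $ i" i] normY_component[of z i]
        by (auto intro: S_in)
      then have "normY U (S i \<sigma> (S i \<tau>0 ?y) - S i \<tau>0 ?y) \<le> \<epsilon> / real CARD('n)"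
        using that by (intro \<delta>') auto
      moreover have "S i \<tau> (\<lambda>x. z x $ i) = S i \<tau>0 ?y"
        using S_comp[of \<tau>0 "\<tau> - \<tau>0" "\<lambda>x. z x $ i" i] \<tau>0 that zi by simp
      moreover have "(\<lambda>x. (P \<sigma> (P \<tau> z) - P \<tau> z) x $ i) = S i \<sigma> (S i \<tau> (\<lambda>x. z x $ i)) - S i \<tau> (\<lambda>x. z x $ i)"
        by (simp add: fun_eq_iff P_component)
      ultimately show "normY U (\<lambda>x. (P \<sigma> (P \<tau> z) - P \<tau> z) x $ i) \<le> \<epsilon> / real CARD('n)" by simp
    qed
    finally show ?thesis by simp
  qed
  moreover have "0 < Min (range \<delta>)" using \<delta> by simp
  ultimately show ?thesis by blast
qed

end

section \<open>Increments of mild solutions\<close>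

context compact_contraction_semigroups
begin

text \<open>Evaluating a component of \<open>P h z\<close> at \<open>x\<close> is linear and bounded
  in \<open>z\<close>. Taking \<open>h\<close> positive lets the semigroup act under the integral;
  taking it 0 gives plain evaluation.\<close>

lemma bochner_integral_P_component:
  assumes int: "has_bochner_integral_on X (normX U) a b F w"
    and h: "0 \<le> h" and x: "x \<in> closure U"
  shows "(\<lambda>t. P h (F t) x $ i) absolutely_integrable_on {a..b}"
    and "integral {a..b} (\<lambda>t. P h (F t) x $ i) = P h w x $ i"
proof -
  have "has_bochner_integral (lebesgue_on {a..b}) (\<lambda>t. P h (F t) x $ i) (P h w x $ i)"
  proof (rule has_bochner_integral_on_functional[where \<phi>="\<lambda>z. P h z x $ i" and V=X, OF _ _ _ _ _ _ _ int])
    show "\<bar>P h v x $ i\<bar> \<le> real CARD('n) * normX U v" if "v \<in> X" for v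
      using component_le_norm1[of "P h v x" i] normX_upper[OF P_in[OF h that] x] P_norm[OF h that]
      by linarith
  qed (auto simp: bc_space_zero bc_space_add bc_space_scaleR P_add[OF h] P_scale[OF h])
  then show *: "(\<lambda>t. P h (F t) x $ i) absolutely_integrable_on {a..b}"
    by (simp add: has_bochner_integral_iff absolutely_integrable_on_iff_nonneg integrable_restrict_space set_integrable_def)
  show "integral {a..b} (\<lambda>t. P h (F t) x $ i) = P h w x $ i"
    using \<open>has_bochner_integral _ _ _\<close> set_lebesgue_integral_eq_integral(2)[OF *]
    by (simp add: has_bochner_integral_iff integral_restrict_space set_lebesgue_integral_def)
qed

text \<open>Under Dirichlet conditions \<open>z\<close> vanishes on the frontier, where
  compatibility makes \<open>f t x 0\<close> vanish too.\<close>

lemma nemytskii_in: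
  assumes cont: "continuous_on (closure U \<times> UNIV) (\<lambda>(x, y). f t x y)"
    and dir: "dirichlet_compatible U bc f" and z: "z \<in> X"
  shows "nemytskii U f t z \<in> X"
proof -
  have "continuous_on (closure U) z"
    using z by (simp add: bc_space_def Cbar_def)
  then have "continuous_on (closure U) (\<lambda>x. case (x, z x) of (x, y) \<Rightarrow> f t x y)"
    by (intro continuous_on_compose2[OF cont] continuous_intros) auto
  then have "continuous_on (closure U) (nemytskii U f t z)"
    by (rule continuous_on_eq) (simp add: nemytskii_def)
  moreover have "nemytskii U f t z x = 0" if "bc = Dirichlet" "x \<in> frontier U" for x
    using dir z that by (simp add: nemytskii_def dirichlet_compatible_def bc_space_def frontier_def)
  ultimately show ?thesis
    by (simp add: bc_space_def Cbar_def) (simp add: nemytskii_def)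
qed

text \<open>By the semigroup law, applying \<open>P (t - t')\<close> to the integral formula at
  \<open>t'\<close> reproduces the initial term and the integrand of the formula at
  \<open>t\<close>, integrated only up to \<open>t'\<close>. The difference is the integral over
  \<open>{t'..t}\<close>, evaluated componentwise at points.\<close>

proposition mild_solution_increment:
  assumes sol: "mild_solution U bc S q1 q2 f z u" and z: "z \<in> X"
    and f: "AE s in lebesgue. continuous_on (closure U \<times> UNIV) (\<lambda>(x, y). f s x y)"
      "dirichlet_compatible U bc f"
    and m: "m_bound U f (ball1 r) m"
    and r: "\<And>t. t \<in> {q1..q2} \<Longrightarrow> normX U (u t) \<le> r"
    and t: "q1 \<le> t'" "t' \<le> t" "t \<le> q2"
  shows "normX U (u t - P (t - t') (u t')) \<le> real CARD('n) * set_lebesgue_integral lebesgue {t'..t} m"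
proof -
  define h where "h = t - t'"
  have h: "0 \<le> h" using t by (simp add: h_def)
  define v where "v s = nemytskii U f s (u s)" for s
  have uX: "u s \<in> X" if "s \<in> {q1..q2}" for s
    using sol that by (simp add: mild_solution_def)
  obtain w where w: "has_bochner_integral_on X (normX U) q1 t (\<lambda>s. P (t - s) (v s)) w"
    and ut: "u t = P (t - q1) z + w"
    using sol t unfolding mild_solution_def v_def by (meson atLeastAtMost_iff order_trans)
  obtain w' where w': "has_bochner_integral_on X (normX U) q1 t' (\<lambda>s. P (t' - s) (v s)) w'"
    and ut': "u t' = P (t' - q1) z + w'"
    using sol t unfolding mild_solution_def v_def by (meson atLeastAtMost_iff order_trans)
  have wX: "w \<in> X" "w' \<in> X"
    using w w' by (simp_all add: has_bochner_integral_on_def)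
  have "P h (u t') = P (t - q1) z + P h w'"
    unfolding ut' using t z wX h P_comp[OF h, of "t' - q1" z]
    by (simp add: P_add P_in h_def)
  then have diff: "u t - P h (u t') = w - P h w'"
    by (simp add: ut)
  note f(1)
  moreover have "AE s in lebesgue. \<forall>x\<in>closure U. \<forall>y\<in>ball1 r. norm1 (f s x y) \<le> m s"
    using m by (simp add: m_bound_def)
  ultimately have v: "AE s in lebesgue. s \<in> {q1..q2} \<longrightarrow> v s \<in> X \<and> normX U (v s) \<le> m s"
  proof eventually_elim
    case (elim s)
    show ?case
    proof
      assume s: "s \<in> {q1..q2}"
      have "normX U (v s) \<le> m s"
      proof (rule normX_least)
        fix x assume x: "x \<in> closure U"
        have "u s x \<in> ball1 r"
          using normX_upper[OF uX[OF s] x] r[OF s] by (simp add: ball1_def)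
        with elim x show "norm1 (v s x) \<le> m s" by (simp add: v_def nemytskii_def)
      qed
      moreover have "v s \<in> X"
        unfolding v_def using elim(1) f(2) uX[OF s] by (rule nemytskii_in)
      ultimately show "v s \<in> X \<and> normX U (v s) \<le> m s" by simp
    qed
  qed
  have m_int: "m absolutely_integrable_on {t'..t}"
    using m by (simp add: m_bound_def L1_loc_def)
  show ?thesis
    unfolding h_def[symmetric] diff
  proof (rule normX_least)
    fix x assume x: "x \<in> closure U"
    define g where "g i s = P (t - s) (v s) x $ i" for i s
    have P0: "P 0 y = y" if "y \<in> X" for y
      using S_zero[OF bc_space_component[OF that]] by (simp add: fun_eq_iff vec_eq_iff P_component)
    \<comment> \<open>The laws of \<open>P\<close> hold on \<open>X\<close> only, and
      \<open>v s\<close> may leave \<open>X\<close> on a null set. The spike rules discard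
      \<open>Z\<close> whenever such a law is used under an integral.\<close>
    obtain Z where "negligible Z"
      and Z_sub: "{s. \<not> (s \<in> {q1..q2} \<longrightarrow> v s \<in> X \<and> normX U (v s) \<le> m s)} \<subseteq> Z"
      using v unfolding eventually_ae_filter_negligible by blast
    then have Z: "negligible Z" "\<And>s. s \<in> {q1..q2} - Z \<Longrightarrow> v s \<in> X"
      by blast+
    have g_abs: "g i absolutely_integrable_on {q1..t}" and g_t: "integral {q1..t} (g i) = w x $ i" for i
    proof -
      have eq: "P 0 (P (t - s) (v s)) x $ i = g i s" if "s \<in> {q1..t} - Z" for s
        using that t Z(2) by (simp add: P0 P_in g_def)
      show "g i absolutely_integrable_on {q1..t}"
        using bochner_integral_P_component(1)[OF w order_refl x, of i]
        by (rule absolutely_integrable_spike[OF _ Z(1)]) (simp add: eq)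
      have "integral {q1..t} (g i) = integral {q1..t} (\<lambda>s. P 0 (P (t - s) (v s)) x $ i)"
        by (rule integral_spike[OF Z(1)]) (simp add: eq)
      then show "integral {q1..t} (g i) = w x $ i"
        using bochner_integral_P_component(2)[OF w order_refl x, of i] by (simp add: P0 wX)
    qed
    \<comment> \<open>The time shift \<open>h\<close> turns \<open>t' - s\<close> into
      \<open>t - s\<close>, so the same \<open>g i\<close> represents both integrals and they can be
      subtracted.\<close>
    have g_t': "integral {q1..t'} (g i) = P h w' x $ i" for i
    proof -
      have "integral {q1..t'} (g i) = integral {q1..t'} (\<lambda>s. P h (P (t' - s) (v s)) x $ i)"
      proof (rule integral_spike[OF Z(1)])
        fix s assume s: "s \<in> {q1..t'} - Z"
        have "P h (P (t' - s) (v s)) = P (h + (t' - s)) (v s)"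
          using s t Z(2)[of s] h by (subst P_comp) auto
        then show "P h (P (t' - s) (v s)) x $ i = g i s" by (simp add: g_def h_def)
      qed
      then show ?thesis using bochner_integral_P_component(2)[OF w' h x, of i] by simp
    qed
    have g_abs': "g i absolutely_integrable_on {t'..t}" for i
      using g_abs by (rule absolutely_integrable_on_subinterval) (use t in auto)
    have comp: "(w - P h w') x $ i = integral {t'..t} (g i)" for i
      using Henstock_Kurzweil_Integration.integral_combine[of q1 t' t "g i"] t g_abs[of i] g_t[of i] g_t'[of i]
      by (simp add: set_lebesgue_integral_eq_integral(1))
    have abs_int: "(\<lambda>s. \<bar>g i s\<bar>) absolutely_integrable_on {t'..t}" for i
      using g_abs'[of i] by (rule set_integrable_abs)
    have "\<bar>(w - P h w') x $ i\<bar> \<le> (LINT s:{t'..t}|lebesgue. \<bar>g i s\<bar>)" for i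
      using set_integral_norm_bound[OF g_abs'[of i]] set_lebesgue_integral_eq_integral(2)[OF g_abs'[of i]]
      unfolding comp by simp
    then have "norm1 ((w - P h w') x) \<le> (\<Sum>i\<in>UNIV. LINT s:{t'..t}|lebesgue. \<bar>g i s\<bar>)"
      unfolding norm1_def by (rule sum_mono)
    \<comment> \<open>Recombining the components into \<open>norm1\<close> before estimating costs
      the factor \<open>CARD('n)\<close> only once.\<close>
    also have "\<dots> = (LINT s:{t'..t}|lebesgue. \<Sum>i\<in>UNIV. \<bar>g i s\<bar>)"
      unfolding set_lebesgue_integral_def scaleR_sum_right
      using abs_int by (subst Bochner_Integration.integral_sum) (auto simp: set_integrable_def)
    also have "\<dots> \<le> (LINT s:{t'..t}|lebesgue. real CARD('n) * m s)"
    proof (rule set_integral_mono_AE)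
      show "AE s in lebesgue. s \<in> {t'..t} \<longrightarrow> (\<Sum>i\<in>UNIV. \<bar>g i s\<bar>) \<le> real CARD('n) * m s"
        using v
      proof eventually_elim
        case (elim s)
        show ?case
        proof
          assume s: "s \<in> {t'..t}"
          with elim t have vs: "v s \<in> X" "normX U (v s) \<le> m s" by auto
          have "(\<Sum>i\<in>UNIV. \<bar>g i s\<bar>) = norm1 (P (t - s) (v s) x)"
            by (simp add: norm1_def g_def)
          also have "\<dots> \<le> normX U (P (t - s) (v s))"
            using s vs x by (intro normX_upper P_in) auto
          also have "\<dots> \<le> real CARD('n) * normX U (v s)"
            using s vs by (intro P_norm) auto
          also have "\<dots> \<le> real CARD('n) * m s"
            using vs by (intro mult_left_mono) auto
          finally show "(\<Sum>i\<in>UNIV. \<bar>g i s\<bar>) \<le> real CARD('n) * m s" .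
        qed
      qed
    qed (use abs_int m_int in \<open>auto intro: absolutely_integrable_sum set_integrable_mult_right\<close>)
    also have "\<dots> = real CARD('n) * set_lebesgue_integral lebesgue {t'..t} m"
      by (rule set_integral_mult_right)
    finally show "norm1 ((w - P h w') x) \<le> real CARD('n) * set_lebesgue_integral lebesgue {t'..t} m" .
  qed
qed

end

section \<open>The moduli and the sets \<open>K\<close>\<close>

context compact_contraction_semigroups
begin

text \<open>The smoothing time \<open>\<tau>\<close> ranges over all values from
  \<open>\<tau>0\<close> on, since splitting a step \<open>\<sigma>\<close> moves the start of its
  later part to a larger time; a fixed \<open>\<tau>\<close> would not give a subadditive
  family.\<close>

definition orbit_increments :: "real \<Rightarrow> (('x \<Rightarrow> real ^ 'n) \<times> real \<times> real) set" where
  "orbit_increments \<tau>0 = {(z, \<sigma>, \<tau>). z \<in> X \<and> normX U z \<le> 1 \<and> 0 \<le> \<sigma> \<and> \<tau>0 \<le> \<tau>}"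

definition semigroup_modulus :: "real \<Rightarrow> real \<Rightarrow> real" where
  "semigroup_modulus \<tau>0 = sup_modulus (orbit_increments \<tau>0) (\<lambda>(z, \<sigma>, \<tau>). \<sigma>)
     (\<lambda>(z, \<sigma>, \<tau>). normX U (P \<sigma> (P \<tau> z) - P \<tau> z))"

text \<open>The increment telescopes through the intermediate state
  \<open>P (\<sigma>2 + \<tau>) z\<close>, whose smoothing time is again at least
  \<open>\<tau>0\<close>. Smallness is the uniform continuity obtained from compactness.\<close>

lemma subadditive_family_orbit_increments:
  assumes "0 < \<tau>0"
  shows "subadditive_family (orbit_increments \<tau>0) (\<lambda>(z, \<sigma>, \<tau>). \<sigma>)
     (\<lambda>(z, \<sigma>, \<tau>). normX U (P \<sigma> (P \<tau> z) - P \<tau> z))"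
proof
  fix p :: "('x \<Rightarrow> real ^ 'n) \<times> real \<times> real" and c d :: real
  assume p: "p \<in> orbit_increments \<tau>0" and cd: "0 \<le> c" "0 \<le> d" and "(case p of (z, \<sigma>, \<tau>) \<Rightarrow> \<sigma>) \<le> c + d"
  then obtain z \<sigma> \<tau> where pz: "p = (z, \<sigma>, \<tau>)" and z: "z \<in> X" "normX U z \<le> 1"
    and \<sigma>: "0 \<le> \<sigma>" "\<sigma> \<le> c + d" and \<tau>: "\<tau>0 \<le> \<tau>"
    by (auto simp: orbit_increments_def)
  define \<sigma>1 where "\<sigma>1 = min \<sigma> c"
  define \<sigma>2 where "\<sigma>2 = \<sigma> - \<sigma>1"
  have s: "0 \<le> \<sigma>1" "0 \<le> \<sigma>2" "\<sigma>1 \<le> c" "\<sigma>2 \<le> d" "\<sigma> = \<sigma>1 + \<sigma>2"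
    using \<sigma> cd by (auto simp: \<sigma>1_def \<sigma>2_def min_def)
  let ?a = "P (\<sigma>2 + \<tau>) z" and ?b = "P \<tau> z"
  have ab: "?a \<in> X" "?b \<in> X" "?a = P \<sigma>2 ?b"
    using s \<tau> assms z by (auto intro!: P_in P_comp)
  have eq: "P \<sigma> ?b - ?b = (P \<sigma>1 ?a - ?a) + (P \<sigma>2 ?b - ?b)"
    using s ab by (simp add: P_comp)
  have "normX U ((P \<sigma>1 ?a - ?a) + (P \<sigma>2 ?b - ?b))
      \<le> normX U (P \<sigma>1 ?a - ?a) + normX U (P \<sigma>2 ?b - ?b)"
    using s ab(1,2) z(1) \<tau> assms by (intro normX_triangle bc_space_diff P_in) auto
  from this[folded eq] show "\<exists>p1\<in>orbit_increments \<tau>0. \<exists>p2\<in>orbit_increments \<tau>0.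
      (case p1 of (z, \<sigma>, \<tau>) \<Rightarrow> \<sigma>) \<le> c \<and> (case p2 of (z, \<sigma>, \<tau>) \<Rightarrow> \<sigma>) \<le> d \<and>
      (case p of (z, \<sigma>, \<tau>) \<Rightarrow> normX U (P \<sigma> (P \<tau> z) - P \<tau> z))
        \<le> (case p1 of (z, \<sigma>, \<tau>) \<Rightarrow> normX U (P \<sigma> (P \<tau> z) - P \<tau> z)) +
           (case p2 of (z, \<sigma>, \<tau>) \<Rightarrow> normX U (P \<sigma> (P \<tau> z) - P \<tau> z))"
    using s z \<tau> pz
    by (intro bexI[of _ "(z, \<sigma>1, \<sigma>2 + \<tau>)"] bexI[of _ "(z, \<sigma>2, \<tau>)"]) (auto simp: orbit_increments_def)
next
  fix \<epsilon> :: real assume "0 < \<epsilon>"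
  from P_uniformly_continuous[OF assms this] obtain \<delta> where "0 < \<delta>"
    and \<delta>: "\<And>\<sigma> \<tau> z. 0 \<le> \<sigma> \<Longrightarrow> \<sigma> < \<delta> \<Longrightarrow> \<tau>0 \<le> \<tau> \<Longrightarrow> z \<in> X \<Longrightarrow> normX U z \<le> 1 \<Longrightarrow>
      normX U (P \<sigma> (P \<tau> z) - P \<tau> z) \<le> \<epsilon>" by blast
  then show "\<exists>\<delta>>0. \<forall>p\<in>orbit_increments \<tau>0. (case p of (z, \<sigma>, \<tau>) \<Rightarrow> \<sigma>) < \<delta> \<longrightarrow>
      (case p of (z, \<sigma>, \<tau>) \<Rightarrow> normX U (P \<sigma> (P \<tau> z) - P \<tau> z)) \<le> \<epsilon>"
    by (intro exI[of _ \<delta>]) (auto simp: orbit_increments_def)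
qed

lemma modulus_semigroup_modulus: "0 < \<tau>0 \<Longrightarrow> modulus (semigroup_modulus \<tau>0)"
  unfolding semigroup_modulus_def
  by (intro subadditive_family.modulus_sup_modulus subadditive_family_orbit_increments)

lemma semigroup_modulus_nonneg: "0 < \<tau>0 \<Longrightarrow> 0 \<le> semigroup_modulus \<tau>0 s"
  unfolding semigroup_modulus_def
  by (intro subadditive_family.sup_modulus_nonneg subadditive_family_orbit_increments)

text \<open>A larger lower bound for the smoothing time leaves fewer orbits in the supremum. With
  the bound \<open>1 / \<nu>\<close> this becomes monotonicity in \<open>\<nu>\<close>.\<close>

lemma semigroup_modulus_antimono:
  "0 < \<tau>1 \<Longrightarrow> \<tau>1 \<le> \<tau>2 \<Longrightarrow> semigroup_modulus \<tau>2 s \<le> semigroup_modulus \<tau>1 s"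
  unfolding semigroup_modulus_def
  by (intro sup_modulus_mono_family subadditive_family_orbit_increments) (auto simp: orbit_increments_def)

lemma orbit_increment_le:
  assumes \<tau>: "0 < \<tau>" and \<sigma>: "0 \<le> \<sigma>" and z: "z \<in> X" "normX U z \<le> r" and r: "0 < r"
  shows "normX U (P \<sigma> (P \<tau> z) - P \<tau> z) \<le> r * semigroup_modulus \<tau> \<sigma>"
proof -
  define y where "y = (\<lambda>x. (1 / r) *\<^sub>R z x)"
  have y: "y \<in> X" unfolding y_def using z(1) by (rule bc_space_scaleR)
  have "normX U y \<le> 1"
  proof -
    have "normX U y \<le> normX U z / r"
      using normX_scale_le[OF z(1), of "1 / r"] r by (simp add: y_def)
    also have "\<dots> \<le> 1" using z(2) r by simp
    finally show ?thesis .
  qed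
  then have le: "normX U (P \<sigma> (P \<tau> y) - P \<tau> y) \<le> semigroup_modulus \<tau> \<sigma>"
    unfolding semigroup_modulus_def
    using subadditive_family.sup_modulus_ge[OF subadditive_family_orbit_increments[OF \<tau>], of "(y, \<sigma>, \<tau>)" \<sigma>] y \<sigma>
    by (simp add: orbit_increments_def)
  have z_eq: "z = (\<lambda>x. r *\<^sub>R y x)" using r by (simp add: y_def)
  have P\<tau>: "P \<tau> z = (\<lambda>x. r *\<^sub>R P \<tau> y x)"
    unfolding z_eq using \<tau> y by (intro P_scale) auto
  have "P \<sigma> (P \<tau> z) = (\<lambda>x. r *\<^sub>R P \<sigma> (P \<tau> y) x)"
    unfolding P\<tau> using \<sigma> \<tau> y by (intro P_scale P_in) auto
  with P\<tau> have "P \<sigma> (P \<tau> z) - P \<tau> z = (\<lambda>x. r *\<^sub>R (P \<sigma> (P \<tau> y) - P \<tau> y) x)"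
    by (simp add: fun_eq_iff scaleR_diff_right)
  then have "normX U (P \<sigma> (P \<tau> z) - P \<tau> z) \<le> \<bar>r\<bar> * normX U (P \<sigma> (P \<tau> y) - P \<tau> y)"
    using normX_scale_le[of "P \<sigma> (P \<tau> y) - P \<tau> y" r] y \<sigma> \<tau> by (simp add: bc_space_diff P_in)
  also have "\<dots> \<le> r * semigroup_modulus \<tau> \<sigma>"
    using mult_left_mono[OF le, of r] r by simp
  finally show ?thesis .
qed

text \<open>Restarting at \<open>t1 - h\<close> smooths the state for a time \<open>h\<close>, so that the oscillation of \<open>u\<close> after
  \<open>t1\<close> is controlled uniformly, without any regularity of \<open>u\<close> before \<open>t1 - h\<close>.\<close>

lemma increment_le_restart:
  assumes uX: "\<And>t. t \<in> {a..b} \<Longrightarrow> u t \<in> X" and r: "\<And>t. t \<in> {a..b} \<Longrightarrow> normX U (u t) \<le> r" "0 < r"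
    and restart: "\<And>t t'. a \<le> t' \<Longrightarrow> t' \<le> t \<Longrightarrow> t \<le> b \<Longrightarrow> normX U (u t - P (t - t') (u t')) \<le> \<omega> (t - t')"
    and h: "0 < h" and t: "a + h \<le> t1" "t1 \<le> t2" "t2 \<le> b"
  shows "normX U (u t2 - u t1) \<le> r * semigroup_modulus h (t2 - t1) + \<omega> (t2 - t1) + (real CARD('n) + 1) * \<omega> h"
proof -
  define \<sigma> where "\<sigma> = t2 - t1"
  define y where "y = u (t1 - h)"
  have \<sigma>: "0 \<le> \<sigma>" using t by (simp add: \<sigma>_def)
  have X: "u t1 \<in> X" "u t2 \<in> X" "y \<in> X" "normX U y \<le> r"
    using t h by (auto simp: y_def intro!: uX r)
  have Py: "P h y \<in> X" using X h by (intro P_in) auto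
  have 1: "normX U (u t2 - P \<sigma> (u t1)) \<le> \<omega> \<sigma>"
    unfolding \<sigma>_def using t h by (intro restart) auto
  have 2: "normX U (P \<sigma> (P h y) - P h y) \<le> r * semigroup_modulus h \<sigma>"
    using h \<sigma> X(3,4) r(2) by (rule orbit_increment_le)
  have 3: "normX U (u t1 - P h y) \<le> \<omega> h"
    using restart[of "t1 - h" t1] t h by (simp add: y_def)
  have 4: "normX U (P \<sigma> (u t1 - P h y)) \<le> real CARD('n) * \<omega> h"
    using P_norm[OF \<sigma> bc_space_diff[OF X(1) Py]] 3
    by (meson mult_left_mono of_nat_0_le_iff order_trans)
  \<comment> \<open>The path runs through \<open>P \<sigma> (u t1)\<close>,
    \<open>P \<sigma> (P h y)\<close> and \<open>P h y\<close>. The restart error over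
    \<open>h\<close> occurs once under \<open>P \<sigma>\<close> and once bare, which gives its
    factor \<open>CARD('n) + 1\<close>.\<close>
  have eq: "u t2 - u t1 = (u t2 - P \<sigma> (u t1)) + ((P \<sigma> (P h y) - P h y) + (P \<sigma> (u t1 - P h y) + (P h y - u t1)))"
    using \<sigma> X Py by (simp add: P_diff)
  have "normX U ((u t2 - P \<sigma> (u t1)) + ((P \<sigma> (P h y) - P h y) + (P \<sigma> (u t1 - P h y) + (P h y - u t1))))
      \<le> normX U (u t2 - P \<sigma> (u t1)) + (normX U (P \<sigma> (P h y) - P h y) +
      (normX U (P \<sigma> (u t1 - P h y)) + normX U (P h y - u t1)))"
    using \<sigma> X Py h
    by (intro order_trans[OF normX_triangle] add_left_mono normX_triangle bc_space_add bc_space_diff P_in) auto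
  from this[folded eq] show ?thesis
    using 1 2 3 4 normX_minus_commute[of "P h y" "u t1"]
    unfolding \<sigma>_def[symmetric] distrib_right mult_1 by linarith
qed

lemma dist_to_smoothed_ball_le:
  assumes y: "y \<in> X" "normX U y \<le> r" and v: "v \<in> X" and h: "0 \<le> h"
  shows "dist_to_set (normX U) v (P h ` (cball_C U r \<inter> X)) \<le> normX U (v - P h y)"
  unfolding dist_to_set_def
proof (rule cINF_lower)
  show "bdd_below ((\<lambda>z'. normX U (v - z')) ` P h ` (cball_C U r \<inter> X))"
    using v h by (intro bdd_belowI2[of _ 0]) (auto intro!: normX_nonneg bc_space_diff P_in)
  have "y \<in> cball_C U r"
    unfolding cball_C_def ball1_def
    using y normX_upper[OF y(1)] order_trans by (fastforce simp: bc_space_def)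
  then show "P h y \<in> P h ` (cball_C U r \<inter> X)"
    using y(1) by blast
qed

end

section \<open>From the Laplacian and the \<open>m\<close>-bounds to the final moduli\<close>

lemma laplace_semigroup_compact_contraction:
  assumes "smooth_domain U" "\<And>i. laplace_semigroup U bc i (S i)"
  shows "compact_contraction_semigroups U bc S"
proof
  show "U \<noteq> {}" "bounded U"
    using assms(1) by (simp_all add: smooth_domain_def)
  fix i and t :: real
  note S = assms(2)[of i, unfolded laplace_semigroup_def]
  show "C0_semigroup (bc_space U bc) (normY U) (S i)"
    using S by blast
  show "0 < t \<Longrightarrow> compact_op (bc_space U bc) (normY U) (S i t)"
    using S by blast
  show "0 \<le> t \<Longrightarrow> op_norm (bc_space U bc) (normY U) (S i t) \<le> 1"
    using S by blast
qed

text \<open>The sets \<open>M i\<close> for different \<open>i\<close> are chosen independently, so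
  the term with index \<open>j\<close> alone need not increase with \<open>j\<close>. Summing
  nonnegative moduli up to \<open>j\<close> forces monotonicity and still dominates the last
  term.\<close>

definition integral_modulus :: "(nat \<Rightarrow> (real \<Rightarrow> real) set) \<Rightarrow> nat \<Rightarrow> real set \<Rightarrow> real \<Rightarrow> real" where
  "integral_modulus M j I s = (\<Sum>i=1..j. sup_modulus {(m, c, d). m \<in> M i \<and> Inf I \<le> c \<and> c \<le> d \<and> d \<le> Sup I}
     (\<lambda>(m, c, d). d - c) (\<lambda>(m, c, d). set_lebesgue_integral lebesgue {c..d} m) s)"

locale equicontinuous_families =
  fixes M :: "nat \<Rightarrow> (real \<Rightarrow> real) set"
  assumes family: "\<And>i a b. 1 \<le> i \<Longrightarrow> subadditive_family {(m, c, d). m \<in> M i \<and> a \<le> c \<and> c \<le> d \<and> d \<le> b}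
    (\<lambda>(m, c, d). d - c) (\<lambda>(m, c, d). set_lebesgue_integral lebesgue {c..d} m)"
begin

lemma modulus_integral_modulus: "modulus (integral_modulus M j I)"
  unfolding integral_modulus_def
  by (intro modulus_sum subadditive_family.modulus_sup_modulus family) auto

lemma integral_modulus_mono:
  assumes "j1 \<le> j2" "rat_interval I1" "rat_interval I2" "I1 \<subseteq> I2"
  shows "integral_modulus M j1 I1 s \<le> integral_modulus M j2 I2 s"
proof -
  have I: "Inf I2 \<le> Inf I1" "Sup I1 \<le> Sup I2"
    using assms(2-) by (auto simp: rat_interval_def)
  have "integral_modulus M j1 I1 s \<le> integral_modulus M j1 I2 s"
    unfolding integral_modulus_def
    using I by (intro sum_mono sup_modulus_mono_family family) auto
  also have "\<dots> \<le> integral_modulus M j2 I2 s"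
    unfolding integral_modulus_def
    using assms(1) by (intro sum_mono2 subadditive_family.sup_modulus_nonneg family) auto
  finally show ?thesis .
qed

lemma integral_le_integral_modulus:
  assumes "m \<in> M j" "1 \<le> j" "a \<le> c" "c \<le> d" "d \<le> b"
  shows "set_lebesgue_integral lebesgue {c..d} m \<le> integral_modulus M j {a..b} (d - c)"
proof -
  let ?f = "\<lambda>i. sup_modulus {(m, c, d). m \<in> M i \<and> a \<le> c \<and> c \<le> d \<and> d \<le> b}
     (\<lambda>(m, c, d). d - c) (\<lambda>(m, c, d). set_lebesgue_integral lebesgue {c..d} m) (d - c)"
  have "set_lebesgue_integral lebesgue {c..d} m \<le> ?f j"
    using subadditive_family.sup_modulus_ge[OF family[OF assms(2)], of "(m, c, d)" a b "d - c"] assms by simp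
  also have "\<dots> \<le> (\<Sum>i=1..j. ?f i)"
    using assms(2) by (intro member_le_sum subadditive_family.sup_modulus_nonneg family) auto
  also have "\<dots> = integral_modulus M j {a..b} (d - c)"
    using assms by (simp add: integral_modulus_def)
  finally show ?thesis .
qed

end

theorem proposition4p4:
  fixes U :: "(real ^ 'm) set"
    and bc :: "(real ^ 'm, 'n::finite) bdry_cond"
    and S :: "'n \<Rightarrow> real \<Rightarrow> (real ^ 'm \<Rightarrow> real) \<Rightarrow> (real ^ 'm \<Rightarrow> real)"
    and E :: "(real \<Rightarrow> real ^ 'm \<Rightarrow> real ^ 'n \<Rightarrow> real ^ 'n) set"
  assumes "smooth_domain U"
    and "admissible_bc U bc"
    and "\<And>i. laplace_semigroup U bc i (S i)"
    and "E \<subseteq> LC U"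
    and "\<And>f. f \<in> E \<Longrightarrow> dirichlet_compatible U bc f"
    and "equicontinuous_m_bounds U E"
  shows "\<exists>\<theta>1 \<theta>2 R. suitable_moduli \<theta>1 \<theta>2 \<and> suitable_radii R \<and>
    (\<forall>q1\<in>\<rat>. \<forall>q2\<in>\<rat>. q1 < q2 \<longrightarrow>
      (\<forall>f\<in>E. \<forall>z\<in>bc_space U bc. \<forall>u. mild_solution U bc S q1 q2 f z u \<longrightarrow>
        (\<forall>j\<ge>1. (\<forall>t\<in>{q1..q2}. normX U (u t) \<le> real j) \<longrightarrow>
          u \<in> K_set U bc S \<theta>1 \<theta>2 R j {q1..q2})))"
proof -
  interpret compact_contraction_semigroups U bc S
    using assms(1,3) by (rule laplace_semigroup_compact_contraction)
  \<comment> \<open>Packing the conditions into one predicate allows a choice of bounds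
    \<open>M j\<close> for all levels simultaneously.\<close>
  define good where "good j Sj \<longleftrightarrow>
     (\<forall>m\<in>Sj. \<exists>f\<in>E. m_bound U f (ball1 (real j)) m) \<and>
     (\<forall>f\<in>E. \<exists>m\<in>Sj. m_bound U f (ball1 (real j)) m) \<and>
     (\<forall>r>0. \<forall>\<epsilon>>0. \<exists>\<delta>>0. \<forall>t1 t2. - r \<le> t1 \<and> t1 \<le> t2 \<and> t2 \<le> r \<and> t2 - t1 < \<delta> \<longrightarrow>
        (SUP m\<in>Sj. ereal (set_lebesgue_integral lebesgue {t1..t2} m)) < ereal \<epsilon>)" for j :: nat and Sj
  have "\<forall>j\<ge>1. \<exists>Sj. good j Sj"
    using assms(6) unfolding equicontinuous_m_bounds_def good_def .
  then obtain M where good: "\<And>j. 1 \<le> j \<Longrightarrow> good j (M j)" by metis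
  have M_bound: "\<exists>f\<in>E. m_bound U f (ball1 (real j)) m" if "1 \<le> j" "m \<in> M j" for j m
    using good[OF that(1)] that(2) unfolding good_def by blast
  have bound_M: "\<exists>m\<in>M j. m_bound U f (ball1 (real j)) m" if "1 \<le> j" "f \<in> E" for j f
    using good[OF that(1)] that(2) unfolding good_def by blast
  have equi: "\<exists>\<delta>>0. \<forall>t1 t2. - r \<le> t1 \<and> t1 \<le> t2 \<and> t2 \<le> r \<and> t2 - t1 < \<delta> \<longrightarrow>
        (SUP m\<in>M j. ereal (set_lebesgue_integral lebesgue {t1..t2} m)) < ereal \<epsilon>"
    if "1 \<le> j" "r > 0" "\<epsilon> > 0" for j r \<epsilon>
    using good[OF that(1)] that(2,3) unfolding good_def by blast
  interpret equicontinuous_families M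
  proof (rule equicontinuous_families.intro)
    fix i :: nat and a b :: real assume i: "1 \<le> i"
    have "m \<in> L1_loc" if "m \<in> M i" for m
      using M_bound[OF i that] by (auto simp: m_bound_def)
    then show "subadditive_family {(m, c, d). m \<in> M i \<and> a \<le> c \<and> c \<le> d \<and> d \<le> b}
        (\<lambda>(m, c, d). d - c) (\<lambda>(m, c, d). set_lebesgue_integral lebesgue {c..d} m)"
      using equi[OF i] by (rule subadditive_family_integrals)
  qed
  let ?N = "real CARD('n)"
  define \<Omega> where "\<Omega> = integral_modulus M"
  \<comment> \<open>The restart error over \<open>1 / \<nu>\<close> is at most
    \<open>?N * \<Omega>\<close> and enters the oscillation \<open>?N + 1\<close> times; this
    constant also covers its single occurrence in the distance estimate. In
    \<open>\<theta>2\<close>, the factor \<open>j\<close> scales the unit-ball modulus to states of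
    norm at most \<open>j\<close>.\<close>
  define \<theta>1 where "\<theta>1 j I s = ?N * (?N + 1) * \<Omega> j I s" for j I s
  define \<theta>2 where "\<theta>2 j I \<nu> s = real j * semigroup_modulus (1 / real \<nu>) s + ?N * \<Omega> j I s" for j I \<nu> s
  define R where "R j I = real j" for j :: nat and I :: "real set"
  have \<Omega>_nonneg: "0 \<le> \<Omega> j I s" if "0 \<le> s" for j I s
    using modulus_integral_modulus[of j I] that by (auto simp: modulus_def \<Omega>_def)
  have "suitable_moduli \<theta>1 \<theta>2"
    unfolding suitable_moduli_def
  proof (intro conjI allI impI)
    fix j :: nat and I
    show "modulus (\<theta>1 j I)"
      unfolding \<theta>1_def[abs_def] \<Omega>_def by (intro modulus_cmult modulus_integral_modulus) auto
  next
    fix j :: nat and I and \<nu> :: nat assume "1 \<le> j \<and> 1 \<le> \<nu> \<and> rat_interval I \<and> Inf I + 1 / real \<nu> < Sup I"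
    then show "modulus (\<theta>2 j I \<nu>)"
      unfolding \<theta>2_def[abs_def] \<Omega>_def
      by (intro modulus_add modulus_cmult modulus_integral_modulus modulus_semigroup_modulus) auto
  next
    fix j1 j2 :: nat and I1 I2 and s :: real
    assume "1 \<le> j1 \<and> j1 \<le> j2 \<and> rat_interval I1 \<and> rat_interval I2 \<and> I1 \<subseteq> I2" "0 \<le> s"
    then show "\<theta>1 j1 I1 s \<le> \<theta>1 j2 I2 s"
      unfolding \<theta>1_def \<Omega>_def by (intro mult_left_mono integral_modulus_mono) auto
  next
    fix j1 j2 :: nat and I1 I2 and \<nu>1 \<nu>2 :: nat and s :: real
    assume *: "1 \<le> j1 \<and> j1 \<le> j2 \<and> 1 \<le> \<nu>1 \<and> \<nu>1 \<le> \<nu>2 \<and>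
        rat_interval I1 \<and> rat_interval I2 \<and> I1 \<subseteq> I2 \<and> Inf I1 + 1 / real \<nu>1 < Sup I1" "0 \<le> s"
    then have "1 / real \<nu>2 \<le> 1 / real \<nu>1" "0 < 1 / real \<nu>2"
      by (auto intro!: divide_left_mono)
    with * show "\<theta>2 j1 I1 \<nu>1 s \<le> \<theta>2 j2 I2 \<nu>2 s"
      unfolding \<theta>2_def \<Omega>_def
      by (intro add_mono mult_mono integral_modulus_mono semigroup_modulus_antimono
          semigroup_modulus_nonneg mult_left_mono) auto
  qed
  moreover have "suitable_radii R"
    by (auto simp: suitable_radii_def R_def)
  moreover have "u \<in> K_set U bc S \<theta>1 \<theta>2 R j {q1..q2}"
    if f: "f \<in> E" and z: "z \<in> X" and sol: "mild_solution U bc S q1 q2 f z u"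
      and j: "1 \<le> j" and uj: "\<And>t. t \<in> {q1..q2} \<Longrightarrow> normX U (u t) \<le> real j" for q1 q2 f z u j
  proof -
    obtain m where m: "m \<in> M j" "m_bound U f (ball1 (real j)) m"
      using bound_M[OF j f] by blast
    have cont: "AE s in lebesgue. continuous_on (closure U \<times> UNIV) (\<lambda>(x, y). f s x y)"
      using f assms(4) by (auto simp: LC_def SC_def)
    have uX: "u t \<in> X" if "t \<in> {q1..q2}" for t
      using sol that by (simp add: mild_solution_def)
    \<comment> \<open>The estimate uses the modulus of the subinterval \<open>{r1..r2}\<close>,
      because \<open>K_set\<close> tests each rational subinterval against its own moduli.\<close>
    have restart: "normX U (u t - P (t - t') (u t')) \<le> ?N * \<Omega> j {r1..r2} (t - t')"
      if "{r1..r2} \<subseteq> {q1..q2}" "r1 \<le> t'" "t' \<le> t" "t \<le> r2" for r1 r2 t t'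
    proof -
      have "q1 \<le> t'" "t \<le> q2" using that by auto
      then have "normX U (u t - P (t - t') (u t')) \<le> ?N * set_lebesgue_integral lebesgue {t'..t} m"
        using mild_solution_increment[OF sol z cont assms(5)[OF f] m(2) uj] that(3) by simp
      also have "\<dots> \<le> ?N * \<Omega> j {r1..r2} (t - t')"
        unfolding \<Omega>_def using m(1) j that by (intro mult_left_mono integral_le_integral_modulus) auto
      finally show ?thesis .
    qed
    show ?thesis
      unfolding K_set_def
    proof (intro CollectI conjI ballI allI impI)
      show "cont_curve (normX U) {q1..q2} u"
        using sol by (simp add: mild_solution_def)
      show "u t \<in> cball_C U (real j)" if "t \<in> {q1..q2}" for t
        using normX_upper[OF uX[OF that]] uj[OF that] uX[OF that] order_trans
        by (fastforce simp: cball_C_def ball1_def bc_space_def)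
    next
      fix r1 r2 :: real and \<nu> :: nat and t1 t2
      assume "r1 < r2 \<and> {r1..r2} \<subseteq> {q1..q2} \<and> 1 \<le> \<nu> \<and> r1 + 1 / real \<nu> < r2"
        and t: "t1 \<in> {r1 + 1 / real \<nu>..r2}" "t2 \<in> {r1 + 1 / real \<nu>..r2}"
      then have sub: "{r1..r2} \<subseteq> {q1..q2}" and \<nu>: "0 < 1 / real \<nu>" by auto
      \<comment> \<open>Ordered times suffice, the norm of a difference being symmetric.\<close>
      have le: "normX U (u t2 - u t1)
          \<le> \<theta>2 j {r1..r2} \<nu> (t2 - t1) + \<theta>1 j {r1..r2} (1 / real \<nu>)"
        if "t1 \<in> {r1 + 1 / real \<nu>..r2}" "t2 \<in> {r1 + 1 / real \<nu>..r2}" "t1 \<le> t2" for t1 t2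
      proof -
        have "normX U (u t2 - u t1) \<le> real j * semigroup_modulus (1 / real \<nu>) (t2 - t1) +
            ?N * \<Omega> j {r1..r2} (t2 - t1) + (?N + 1) * (?N * \<Omega> j {r1..r2} (1 / real \<nu>))"
        proof (rule increment_le_restart[where a=r1 and b=r2])
          show "normX U (u t - P (t - t') (u t')) \<le> ?N * \<Omega> j {r1..r2} (t - t')"
            if "r1 \<le> t'" "t' \<le> t" "t \<le> r2" for t t'
            using sub that by (rule restart)
          show "u t \<in> X" "normX U (u t) \<le> real j" if "t \<in> {r1..r2}" for t
            using sub that by (auto intro!: uX uj)
        qed (use that j \<nu> in auto)
        then show ?thesis
          by (simp add: \<theta>1_def \<theta>2_def algebra_simps)
      qed
      show "normX U (u t1 - u t2) \<le> \<theta>2 j {r1..r2} \<nu> \<bar>t1 - t2\<bar> + \<theta>1 j {r1..r2} (1 / real \<nu>)"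
        using le[OF t] le[OF t(2,1)] normX_minus_commute[of "u t1" "u t2"] by (cases "t1 \<le> t2") auto
    next
      fix r1 r2 :: real and \<nu> :: nat and t
      assume "r1 < r2 \<and> {r1..r2} \<subseteq> {q1..q2} \<and> 1 \<le> \<nu> \<and> r1 + 1 / real \<nu> < r2"
        and t: "t \<in> {r1 + 1 / real \<nu>..r2}"
      then have sub: "{r1..r2} \<subseteq> {q1..q2}" and \<nu>: "0 < 1 / real \<nu>" by auto
      \<comment> \<open>Going back by \<open>1 / \<nu>\<close> stays in \<open>{r1..r2}\<close>, so
        \<open>u ?t'\<close> has norm at most \<open>j\<close> and its smoothed image is an
        admissible competitor in the distance.\<close>
      let ?t' = "t - 1 / real \<nu>"
      have tt: "t \<in> {q1..q2}" "?t' \<in> {q1..q2}" "r1 \<le> ?t'"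
      proof -
        have "t \<in> {r1..r2}" "?t' \<in> {r1..r2}"
          using t \<nu> unfolding atLeastAtMost_iff by linarith+
        with sub show "t \<in> {q1..q2}" "?t' \<in> {q1..q2}" "r1 \<le> ?t'" by auto
      qed
      have "dist_to_set (normX U) (u t) (P (1 / real \<nu>) ` (cball_C U (R j {r1..r2}) \<inter> X))
          \<le> normX U (u t - P (1 / real \<nu>) (u ?t'))"
        unfolding R_def using tt(1,2) \<nu> by (intro dist_to_smoothed_ball_le uX uj less_imp_le)
      also have "\<dots> \<le> ?N * \<Omega> j {r1..r2} (1 / real \<nu>)"
      proof -
        have "?t' \<le> t" "t \<le> r2" using t \<nu> by auto
        from restart[OF sub tt(3) this] show ?thesis by simp
      qed
      also have "\<dots> \<le> \<theta>1 j {r1..r2} (1 / real \<nu>)"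
        unfolding \<theta>1_def using \<Omega>_nonneg[of "1 / real \<nu>" j "{r1..r2}"]
        by (intro mult_right_mono) (auto simp: mult_le_cancel_left1)
      finally show "dist_to_set (normX U) (u t) (P (1 / real \<nu>) ` (cball_C U (R j {r1..r2}) \<inter> X))
          \<le> \<theta>1 j {r1..r2} (1 / real \<nu>)" .
    qed
  qed
  ultimately show ?thesis
    by (intro exI[of _ \<theta>1] exI[of _ \<theta>2] exI[of _ R] conjI ballI allI impI) simp_all
qed

end
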